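(* Let $X$ be a filtered simplicial complex and let $\mathcal V\prec\mathcal U$ be covers of $X$ by filtered subcomplexes. The $2$-morphism of spectral sequences $E^{\ge2}_{*,*}(X,\mathcal V)\to E^{\ge2}_{*,*}(X,\mathcal U)$ obtained by restricting $\rho^{\mathcal U,\mathcal V}_{*,*}$ to pages $\ge2$ is independent of the particular choice of refinement map $\rho^{\mathcal U,\mathcal V}:N_{\mathcal V}\to N_{\mathcal U}$.
   Context: Homology has coefficients in a fixed field. A filtered simplicial complex $X$ is a functor $r\mapsto X_r$ from $(\mathbb R,\le)$ to finite simplicial complexes with all maps inclusions of subcomplexes. A cover $\mathcal U$ of $X$ by filtered subcomplexes has nerve $N_{\mathcal U}$ ($N_{\mathcal U}^p$ its set of $p$-simplices), and $\mathcal U_\sigma$ is the intersection of the members in $\sigma\in N_{\mathcal U}$. $\mathcal V\prec\mathcal U$ means every $V\in\mathcal V$ is contained in some $U\in\mathcal U$; a refinement map is a simplicial map $\rho^{\mathcal U,\mathcal V}:N_{\mathcal V}\to N_{\mathcal U}$ with $\mathcal V_\sigma\subseteq\mathcal U_{\rho\sigma}$ for all $\sigma\in N_{\mathcal V}$. $C_{p,q}(X,\mathcal U)=\bigoplus_{\sigma\in N_{\mathcal U}^p}C_q(\mathcal U_\sigma)$ (functorially in the filtration parameter) is a double complex with the Čech differential horizontally and $(-1)^p$ times the simplicial (cellular) differential vertically; $E^*_{p,q}(X,\mathcal U)$ is the spectral sequence of its total complex filtered by $p$, so $E^1_{p,q}=\bigoplus_{\sigma\in N^p_{\mathcal U}}\mathrm{PH}_q(\mathcal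 U_\sigma)$. Write $(\sigma)_a$ for the generator of $C_{p,q}$ given by the (oriented) simplex $\sigma\in N^p$ and the $q$-cell $a$ of the corresponding intersection. The map $\rho_{p,q}^{\mathcal U,\mathcal V}:C_{p,q}(X,\mathcal V)\to C_{p,q}(X,\mathcal U)$ sends $(\sigma)_a$ to $(\rho^{\mathcal U,\mathcal V}\sigma)_a$ if $\dim(\rho^{\mathcal U,\mathcal V}\sigma)=p$ and to $0$ otherwise; it is a morphism of double complexes and induces a morphism of spectral sequences $\rho^{\mathcal U,\mathcal V}_{*,*}:E^*_{*,*}(X,\mathcal V)\to E^*_{*,*}(X,\mathcal U)$. A $2$-morphism is a morphism of spectral sequences defined on pages $\ge2$. *)

theory Defs
  imports
    Complex_Main
    "HOL-Library.FuncSet"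
    "HOL-Library.Function_Algebras"
    "HOL-Library.Groups_Big_Fun"
    "HOL-Combinatorics.Permutations"
    "HOL-Combinatorics.List_Permutation"
begin

section \<open>Filtered simplicial complexes, covers, refinement maps\<close>

text \<open>A simplicial complex is the set of its nonempty simplices.\<close>

definition finite_complex :: "'v set set \<Rightarrow> bool" where
  "finite_complex K \<longleftrightarrow> finite K \<and>
    (\<forall>\<sigma>\<in>K. finite \<sigma> \<and> \<sigma> \<noteq> {} \<and> (\<forall>\<tau>. \<tau> \<subseteq> \<sigma> \<and> \<tau> \<noteq> {} \<longrightarrow> \<tau> \<in> K))"

type_synonym 'v filtered = "real \<Rightarrow> 'v set set"

definition filtered_complex :: "'v filtered \<Rightarrow> bool" where
  "filtered_complex X \<longleftrightarrow> (\<forall>r. finite_complex (X r)) \<and> (\<forall>r s. r \<le> s \<longrightarrow> X r \<subseteq> X s)"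

definition filtered_subcomplex :: "'v filtered \<Rightarrow> 'v filtered \<Rightarrow> bool" where
  "filtered_subcomplex Y X \<longleftrightarrow> filtered_complex Y \<and> (\<forall>r. Y r \<subseteq> X r)"

definition cover :: "'v filtered \<Rightarrow> 'v filtered set \<Rightarrow> bool" where
  "cover X U \<longleftrightarrow> (\<forall>Y\<in>U. filtered_subcomplex Y X) \<and> (\<forall>r. (\<Union>Y\<in>U. Y r) = X r)"

definition inter :: "'v filtered set \<Rightarrow> 'v filtered" where
  "inter \<sigma> r = (\<Inter>Y\<in>\<sigma>. Y r)"

text \<open>A filtered complex is nonempty if it is nonempty at some parameter; the nerve
  does not depend on the filtration parameter.\<close>

definition nerve :: "'v filtered set \<Rightarrow> 'v filtered set set" where
  "nerve U = {\<sigma>. \<sigma> \<subseteq> U \<and> finite \<sigma> \<and> \<sigma> \<noteq> {} \<and> (\<exists>r. inter \<sigma> r \<noteq> {})}"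

definition finer :: "'v filtered set \<Rightarrow> 'v filtered set \<Rightarrow> bool" where
  "finer V U \<longleftrightarrow> (\<forall>A\<in>V. \<exists>B\<in>U. \<forall>r. A r \<subseteq> B r)"

text \<open>A simplicial map of nerves is given by its vertex map; only the values on vertices of
  \<open>nerve V\<close> matter.\<close>

definition refinement_map ::
    "'v filtered set \<Rightarrow> 'v filtered set \<Rightarrow> ('v filtered \<Rightarrow> 'v filtered) \<Rightarrow> bool" where
  "refinement_map V U \<rho> \<longleftrightarrow>
    (\<forall>\<sigma>\<in>nerve V. \<rho> ` \<sigma> \<in> nerve U \<and> (\<forall>r. inter \<sigma> r \<subseteq> inter (\<rho> ` \<sigma>) r))"


section \<open>Oriented chains\<close>

text \<open>An oriented simplex is represented by an ordering of its vertices. As usual for oriented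
  chains, a chain is a function on ordered simplices which changes by the sign of the
  permutation when the vertices are permuted. A chain of the double complex is such a
  function on pairs \<open>(s, a)\<close>, where \<open>s\<close> is an ordered simplex of the nerve and \<open>a\<close>
  an ordered simplex of the corresponding intersection; it is alternating in both arguments.
  The bidegree of \<open>(s, a)\<close> is \<open>(length s - 1, length a - 1)\<close>, so that all the
  \<open>C\<^sub>p\<^sub>,\<^sub>q\<close> live in a single function space, which is their direct sum.\<close>

definition alternating :: "('a list \<Rightarrow> 'k::field) \<Rightarrow> bool" where
  "alternating f \<longleftrightarrow> (\<forall>s \<pi>. \<pi> permutes {..<length s} \<longrightarrow>
     f (permute_list \<pi> s) = of_int (sign \<pi>) * f s)"

type_synonym ('v, 'k) chain = "'v filtered list \<times> 'v list \<Rightarrow> 'k"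

definition bidegree :: "'v filtered list \<times> 'v list \<Rightarrow> int \<times> int" where
  "bidegree x = (int (length (fst x)) - 1, int (length (snd x)) - 1)"

definition tot_chains :: "'v filtered set \<Rightarrow> real \<Rightarrow> ('v, 'k::field) chain set" where
  "tot_chains U r = {c. finite {x. c x \<noteq> 0} \<and>
     (\<forall>s a. c (s, a) \<noteq> 0 \<longrightarrow>
        distinct s \<and> set s \<in> nerve U \<and> distinct a \<and> set a \<in> inter (set s) r) \<and>
     (\<forall>a. alternating (\<lambda>s. c (s, a))) \<and> (\<forall>s. alternating (\<lambda>a. c (s, a)))}"

definition double_complex ::
    "'v filtered set \<Rightarrow> real \<Rightarrow> int \<Rightarrow> int \<Rightarrow> ('v, 'k::field) chain set" where
  "double_complex U r p q = {c \<in> tot_chains U r. \<forall>x. c x \<noteq> 0 \<longrightarrow> bidegree x = (p, q)}"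

text \<open>\<open>generator s a\<close> is the generator \<open>(s)\<^sub>a\<close>: it is \<open>1\<close> on \<open>(s, a)\<close>, is
  determined on the reorderings of \<open>s\<close> and \<open>a\<close> by being alternating, and is zero elsewhere.\<close>

definition orient :: "'a list \<Rightarrow> 'a list \<Rightarrow> 'k::field" where
  "orient s t = (\<Sum>\<pi> | \<pi> permutes {..<length s} \<and> permute_list \<pi> s = t. of_int (sign \<pi>))"

definition generator :: "'v filtered list \<Rightarrow> 'v list \<Rightarrow> ('v, 'k::field) chain" where
  "generator s a = (\<lambda>(t, b). orient s t * orient a b)"

text \<open>The face of \<open>x # t\<close> opposite to \<open>x\<close> is \<open>t\<close>, with sign \<open>+1\<close>; as chains are
  alternating, the coefficient of \<open>t\<close> in a boundary is therefore the sum of the coefficients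
  of all \<open>x # t\<close>. The usual formulas on generators are \<open>cech_diff_generator\<close>,
  \<open>simplicial_diff_generator\<close> and \<open>push_generator\<close> below.\<close>

definition cech_diff :: "('v, 'k::field) chain \<Rightarrow> ('v, 'k) chain" where
  "cech_diff c = (\<lambda>(t, a). if t = [] then 0 else Sum_any (\<lambda>Y. c (Y # t, a)))"

definition simplicial_diff :: "('v, 'k::field) chain \<Rightarrow> ('v, 'k) chain" where
  "simplicial_diff c = (\<lambda>(s, b). if b = [] then 0 else Sum_any (\<lambda>v. c (s, v # b)))"

definition vertical_diff :: "('v, 'k::field) chain \<Rightarrow> ('v, 'k) chain" where
  "vertical_diff c = (\<lambda>(s, b). (- 1) ^ (length s - 1) * simplicial_diff c (s, b))"

definition total_diff :: "('v, 'k::field) chain \<Rightarrow> ('v, 'k) chain" where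
  "total_diff c = cech_diff c + vertical_diff c"

text \<open>The linear map with \<open>(s)\<^sub>a \<mapsto> (\<rho> s)\<^sub>a\<close> if \<open>\<rho>\<close> is injective on \<open>s\<close>, i.e. preserves
  its dimension, and \<open>(s)\<^sub>a \<mapsto> 0\<close> otherwise.\<close>

definition push :: "('v filtered \<Rightarrow> 'v filtered) \<Rightarrow> ('v, 'k::field) chain \<Rightarrow> ('v, 'k) chain" where
  "push \<rho> c = (\<lambda>(t, a). Sum_any (\<lambda>s. if map \<rho> s = t \<and> distinct t then c (s, a) else 0))"


subsection \<open>The maps on generators\<close>

abbreviation omit :: "nat \<Rightarrow> 'a list \<Rightarrow> 'a list" where
  "omit i s \<equiv> take i s @ drop (Suc i) s"

lemma permutes_transposeI:
  assumes "i < n" "j < n"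
  shows "Transposition.transpose i j permutes {..<n::nat}"
  using assms by (intro permutes_swap_id) auto

lemma alternating_transposeI:
  fixes f :: "'a list \<Rightarrow> 'k::field"
  assumes "\<And>s i j. i < length s \<Longrightarrow> j < length s \<Longrightarrow> i \<noteq> j \<Longrightarrow>
    f (permute_list (Transposition.transpose i j) s) = - f s"
  shows "alternating f"
  unfolding alternating_def
proof (intro allI impI)
  fix s :: "'a list" and \<pi>
  assume "\<pi> permutes {..<length s}"
  from finite_lessThan this show "f (permute_list \<pi> s) = of_int (sign \<pi>) * f s"
  proof (induction rule: permutes_rev_induct)
    case id
    then show ?case by simp
  next
    case (swap a b p)
    have t: "Transposition.transpose a b permutes {..<length s}"
      using swap by (intro permutes_transposeI) auto
    have "f (permute_list (p \<circ> Transposition.transpose a b) s)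
        = f (permute_list (Transposition.transpose a b) (permute_list p s))"
      using t by (simp add: permute_list_compose)
    also have "\<dots> = - f (permute_list p s)"
      using swap by (intro assms) auto
    also have "\<dots> = of_int (sign (p \<circ> Transposition.transpose a b)) * f s"
      using swap t permutes_imp_permutation[OF finite_lessThan]
      by (subst sign_compose) (auto simp: sign_swap_id)
    finally show ?case .
  qed
qed

lemma alternating_transpose:
  assumes "alternating f" "i < length s" "j < length s" "i \<noteq> j"
  shows "f (permute_list (Transposition.transpose i j) s) = - f s"
  using assms permutes_transposeI[of i "length s" j]
  unfolding alternating_def by (simp add: sign_swap_id)

lemma permute_list_transpose_Cons:
  assumes "i < length t" "j < length t"
  shows "permute_list (Transposition.transpose (Suc i) (Suc j)) (x # t)
    = x # permute_list (Transposition.transpose i j) t"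
proof (rule nth_equalityI)
  fix m
  assume "m < length (permute_list (Transposition.transpose (Suc i) (Suc j)) (x # t))"
  then have m: "m < Suc (length t)" by simp
  have "permute_list (Transposition.transpose (Suc i) (Suc j)) (x # t) ! m
      = (x # t) ! Transposition.transpose (Suc i) (Suc j) m"
    using assms m by (intro permute_list_nth permutes_transposeI) simp_all
  also have "\<dots> = (x # permute_list (Transposition.transpose i j) t) ! m"
  proof (cases m)
    case 0
    then show ?thesis by (simp add: Transposition.transpose_def)
  next
    case (Suc l)
    have "permute_list (Transposition.transpose i j) t ! l = t ! Transposition.transpose i j l"
      using assms m Suc by (intro permute_list_nth permutes_transposeI) simp_all
    then show ?thesis by (simp add: Suc Transposition.transpose_def)
  qed
  finally show "permute_list (Transposition.transpose (Suc i) (Suc j)) (x # t) ! m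
      = (x # permute_list (Transposition.transpose i j) t) ! m" .
qed simp

lemma alternating_Cons:
  assumes "alternating f"
  shows "alternating (\<lambda>t. f (x # t))"
proof (rule alternating_transposeI)
  fix t :: "'a list" and i j
  assume "i < length t" "j < length t" "i \<noteq> j"
  then show "f (x # permute_list (Transposition.transpose i j) t) = - f (x # t)"
    using alternating_transpose[OF assms, of "Suc i" "x # t" "Suc j"]
    by (simp only: permute_list_transpose_Cons) simp
qed

lemma permute_list_transpose_01:
  "permute_list (Transposition.transpose 0 (Suc 0)) (x # y # zs) = y # x # zs"
proof (rule nth_equalityI)
  fix m
  assume "m < length (permute_list (Transposition.transpose 0 (Suc 0)) (x # y # zs))"
  then have "permute_list (Transposition.transpose 0 (Suc 0)) (x # y # zs) ! m
      = (x # y # zs) ! Transposition.transpose 0 (Suc 0) m"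
    by (intro permute_list_nth permutes_transposeI) simp_all
  also have "\<dots> = (y # x # zs) ! m"
    by (simp add: Transposition.transpose_def nth_Cons split: nat.split)
  finally show "permute_list (Transposition.transpose 0 (Suc 0)) (x # y # zs) ! m
      = (y # x # zs) ! m" .
qed simp

lemma alternating_move:
  fixes f :: "'a list \<Rightarrow> 'k::field"
  assumes "alternating f"
  shows "f (x # xs @ ys) = (- 1) ^ length xs * f (xs @ x # ys)"
  using assms
proof (induction xs arbitrary: f)
  case Nil
  then show ?case by simp
next
  case (Cons y xs)
  have "f (permute_list (Transposition.transpose 0 (Suc 0)) (y # x # xs @ ys))
      = - f (y # x # xs @ ys)"
    by (rule alternating_transpose[OF Cons.prems]) simp_all
  then have "f (x # y # xs @ ys) = - f (y # x # xs @ ys)"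
    unfolding permute_list_transpose_01 .
  also have "f (y # x # xs @ ys) = (- 1) ^ length xs * f (y # xs @ x # ys)"
    by (rule Cons.IH[OF alternating_Cons[OF Cons.prems, of y]])
  finally show ?case by (simp only: append_Cons list.size power_Suc) simp
qed

lemma orient_permuted:
  assumes "orient s t \<noteq> (0::'k::field)"
  shows "mset t = mset s"
proof -
  obtain \<pi> where "\<pi> \<in> {\<pi>. \<pi> permutes {..<length s} \<and> permute_list \<pi> s = t}"
    using assms unfolding orient_def by (rule sum.not_neutral_contains_not_neutral)
  then have \<pi>: "\<pi> permutes {..<length s}" "permute_list \<pi> s = t" by simp_all
  from mset_permute_list[OF \<pi>(1)] \<pi>(2) show ?thesis by (simp only:)
qed

lemma alternating_orient: "alternating (orient s :: 'a list \<Rightarrow> 'k::field)"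
proof (rule alternating_transposeI)
  fix t :: "'a list" and i j :: nat
  let ?\<tau> = "Transposition.transpose i j"
  assume ij: "i < length t" "j < length t" "i \<noteq> j"
  show "orient s (permute_list ?\<tau> t) = (- orient s t :: 'k)"
  proof (cases "length s = length t")
    case True
    have \<tau>: "?\<tau> permutes {..<length s}"
      using ij True by (auto intro: permutes_transposeI)
    have inv: "permute_list ?\<tau> (permute_list ?\<tau> u) = u" if "length u = length s" for u :: "'a list"
      using permute_list_compose[of ?\<tau> u ?\<tau>] \<tau> that by simp
    have "orient s (permute_list ?\<tau> t)
        = (\<Sum>\<pi> | \<pi> permutes {..<length s} \<and> permute_list \<pi> s = t. of_int (sign (\<pi> \<circ> ?\<tau>)) :: 'k)"
      unfolding orient_def
    proof (rule sum.reindex_bij_witness[where i = "\<lambda>\<pi>. \<pi> \<circ> ?\<tau>" and j = "\<lambda>\<pi>. \<pi> \<circ> ?\<tau>"])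
      fix \<pi> assume "\<pi> \<in> {\<pi>. \<pi> permutes {..<length s} \<and> permute_list \<pi> s = permute_list ?\<tau> t}"
      then show "\<pi> \<circ> ?\<tau> \<in> {\<pi>. \<pi> permutes {..<length s} \<and> permute_list \<pi> s = t}"
        using \<tau> inv True by (auto simp: permute_list_compose intro: permutes_compose)
    next
      fix \<pi> assume "\<pi> \<in> {\<pi>. \<pi> permutes {..<length s} \<and> permute_list \<pi> s = t}"
      then show "\<pi> \<circ> ?\<tau> \<in> {\<pi>. \<pi> permutes {..<length s} \<and> permute_list \<pi> s = permute_list ?\<tau> t}"
        using \<tau> by (auto simp: permute_list_compose intro: permutes_compose)
    qed (auto simp: comp_assoc)
    also have "\<dots> = (\<Sum>\<pi> | \<pi> permutes {..<length s} \<and> permute_list \<pi> s = t. - of_int (sign \<pi>))"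
      using \<tau> ij(3) permutes_imp_permutation[OF finite_lessThan]
      by (intro sum.cong refl, subst sign_compose) (auto simp: sign_swap_id)
    finally show ?thesis by (simp add: orient_def sum_negf)
  next
    case False
    then have "orient s (permute_list ?\<tau> t) = (0 :: 'k)" "orient s t = (0 :: 'k)"
      using orient_permuted[of s "permute_list ?\<tau> t"] orient_permuted[of s t]
      by (metis length_permute_list mset_eq_length)+
    then show ?thesis by simp
  qed
qed

lemma orient_self:
  assumes "distinct s"
  shows "orient s s = (1::'k::field)"
proof -
  have "{\<pi>. \<pi> permutes {..<length s} \<and> permute_list \<pi> s = s} = {id}"
  proof (intro equalityI subsetI)
    fix \<pi> assume "\<pi> \<in> {\<pi>. \<pi> permutes {..<length s} \<and> permute_list \<pi> s = s}"
    then have p: "\<pi> permutes {..<length s}" and e: "permute_list \<pi> s = s" by auto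
    have "\<pi> i = i" for i
    proof (cases "i < length s")
      case True
      moreover have "\<pi> i < length s" using p True permutes_in_image[OF p, of i] by simp
      moreover have "s ! \<pi> i = s ! i" using e permute_list_nth[OF p True] by simp
      ultimately show ?thesis using assms nth_eq_iff_index_eq by blast
    next
      case False
      then show ?thesis using p by (simp add: permutes_def)
    qed
    then show "\<pi> \<in> {id}" by (auto simp: fun_eq_iff)
  qed (auto simp: permutes_id)
  then show ?thesis by (simp add: orient_def)
qed

lemma orient_Cons:
  assumes "distinct s"
  shows "orient s (x # t) =
    (\<Sum>i<length s. if s ! i = x then (- 1) ^ i * orient (omit i s) t else (0 :: 'k::field))"
proof (cases "x \<in> set s")
  case False
  then have "orient s (x # t) = (0 :: 'k)"
    using orient_permuted[of s "x # t"] by (metis list.set_intros(1) mset_eq_setD)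
  moreover have "s ! i \<noteq> x" if "i < length s" for i
    using that False by auto
  ultimately show ?thesis by (auto intro!: sum.neutral[symmetric])
next
  case True
  then obtain j where j: "j < length s" "s ! j = x" by (auto simp: in_set_conv_nth)
  have s: "s = take j s @ x # drop (Suc j) s"
    using id_take_nth_drop[OF j(1)] j(2) by simp
  have "orient s (x # t) = (- 1) ^ j * (orient (omit j s) t :: 'k)"
  proof (cases "mset t = mset (omit j s)")
    case True
    then obtain \<pi> where \<pi>: "\<pi> permutes {..<length (omit j s)}" "permute_list \<pi> (omit j s) = t"
      using mset_eq_permutation by blast
    have d: "distinct (omit j s)"
      using assms by (subst (asm) s) auto
    have "orient s (x # omit j s) = (- 1) ^ j * (orient s s :: 'k)"
      using alternating_move[OF alternating_orient[of s], of x "take j s" "drop (Suc j) s"]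
        j(1) s[symmetric] by simp
    then have m: "orient s (x # omit j s) = ((- 1) ^ j :: 'k)"
      by (simp add: orient_self[OF assms])
    have "orient s (x # permute_list \<pi> (omit j s))
        = of_int (sign \<pi>) * (orient s (x # omit j s) :: 'k)"
      using alternating_Cons[OF alternating_orient[of s], of x] \<pi>(1)
      unfolding alternating_def by blast
    then have "orient s (x # t) = of_int (sign \<pi>) * ((- 1) ^ j :: 'k)"
      unfolding \<pi>(2) m .
    moreover have "orient (omit j s) (permute_list \<pi> (omit j s))
        = of_int (sign \<pi>) * (orient (omit j s) (omit j s) :: 'k)"
      using alternating_orient[of "omit j s"] \<pi>(1) unfolding alternating_def by blast
    then have "orient (omit j s) t = (of_int (sign \<pi>) :: 'k)"
      unfolding \<pi>(2) orient_self[OF d] by simp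
    ultimately show ?thesis by simp
  next
    case False
    have "mset s = add_mset x (mset (omit j s))"
      by (subst s) simp
    with False have "mset (x # t) \<noteq> mset s" by simp
    then have "orient s (x # t) = (0 :: 'k)"
      using orient_permuted by blast
    moreover have "orient (omit j s) t = (0 :: 'k)"
      using False orient_permuted by blast
    ultimately show ?thesis by simp
  qed
  moreover have "s ! i = x \<longleftrightarrow> i = j" if "i < length s" for i
    using that j assms nth_eq_iff_index_eq by blast
  then have "(\<Sum>i<length s. if s ! i = x then (- 1) ^ i * orient (omit i s) t else (0 :: 'k))
      = (\<Sum>i<length s. if i = j then (- 1) ^ i * orient (omit i s) t else 0)"
    by (intro sum.cong) auto
  ultimately show ?thesis using j by simp
qed

lemma Sum_any_orient_Cons:
  assumes "distinct s"
  shows "Sum_any (\<lambda>x. orient s (x # t)) = (\<Sum>i<length s. (- 1) ^ i * orient (omit i s) t :: 'k::field)"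
proof -
  have "{x. orient s (x # t) \<noteq> (0::'k)} \<subseteq> set s"
    using orient_permuted by (metis (mono_tags, lifting) list.set_intros(1) mem_Collect_eq mset_eq_setD subsetI)
  then have "Sum_any (\<lambda>x. orient s (x # t)) = (\<Sum>x\<in>set s. orient s (x # t) :: 'k)"
    by (intro Sum_any.expand_superset) auto
  also have "\<dots> = (\<Sum>i<length s. \<Sum>x\<in>set s. if s ! i = x then (- 1) ^ i * orient (omit i s) t else 0)"
    by (simp only: orient_Cons[OF assms]) (rule sum.swap)
  finally show ?thesis by simp
qed

lemma orient_length: "orient s t \<noteq> (0::'k::field) \<Longrightarrow> length t = length s"
  using orient_permuted mset_eq_length by blast

lemma Sum_any_orient_finite: "finite {x. orient s (x # t) \<noteq> (0::'k::field)}"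
proof (rule finite_subset)
  show "{x. orient s (x # t) \<noteq> (0::'k)} \<subseteq> set s"
    using orient_permuted by (metis (mono_tags, lifting) list.set_intros(1) mem_Collect_eq mset_eq_setD subsetI)
qed auto

theorem cech_diff_generator:
  assumes "distinct s" "length s \<ge> 2"
  shows "cech_diff (generator s a) = (\<lambda>x. \<Sum>i<length s. (- 1) ^ i * generator (omit i s) a x :: 'k::field)"
proof
  fix x :: "'a filtered list \<times> 'a list"
  obtain t b where x: "x = (t, b)" by (cases x)
  have 0: "orient (omit i s) [] = (0::'k)" if "i < length s" for i
  proof (rule ccontr)
    assume "orient (omit i s) [] \<noteq> (0::'k)"
    from orient_length[OF this] that assms(2) show False by simp
  qed
  have "Sum_any (\<lambda>Y. orient s (Y # t) * orient a b)
      = (\<Sum>i<length s. (- 1) ^ i * (orient (omit i s) t * orient a b) :: 'k)"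
    using Sum_any_left_distrib[OF Sum_any_orient_finite[of s t, where ?'k = 'k], of "orient a b"]
      Sum_any_orient_Cons[OF assms(1), of t, where ?'k = 'k]
    by (simp add: sum_distrib_right mult.assoc)
  then show "cech_diff (generator s a) x = (\<Sum>i<length s. (- 1) ^ i * generator (omit i s) a x :: 'k)"
    by (auto simp: cech_diff_def generator_def x 0)
qed

theorem simplicial_diff_generator:
  assumes "distinct a" "length a \<ge> 2"
  shows "simplicial_diff (generator s a) =
    (\<lambda>x. \<Sum>i<length a. (- 1) ^ i * generator s (omit i a) x :: 'k::field)"
proof
  fix x :: "'a filtered list \<times> 'a list"
  obtain t b where x: "x = (t, b)" by (cases x)
  have 0: "orient (omit i a) [] = (0::'k)" if "i < length a" for i
  proof (rule ccontr)
    assume "orient (omit i a) [] \<noteq> (0::'k)"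
    from orient_length[OF this] that assms(2) show False by simp
  qed
  have "Sum_any (\<lambda>v. orient s t * orient a (v # b))
      = (\<Sum>i<length a. (- 1) ^ i * (orient s t * orient (omit i a) b) :: 'k)"
    using Sum_any_right_distrib[OF Sum_any_orient_finite[of a b, where ?'k = 'k], of "orient s t"]
      Sum_any_orient_Cons[OF assms(1), of b, where ?'k = 'k]
    by (simp add: sum_distrib_left mult.left_commute)
  then show "simplicial_diff (generator s a) x = (\<Sum>i<length a. (- 1) ^ i * generator s (omit i a) x :: 'k)"
    by (auto simp: simplicial_diff_def generator_def x 0)
qed

theorem push_generator:
  "push \<rho> (generator s a) = (if distinct (map \<rho> s) then generator (map \<rho> s) a else (0 :: ('v, 'k::field) chain))"
proof
  fix x :: "'v filtered list \<times> 'v list"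
  obtain t b where x: "x = (t, b)" by (cases x)
  let ?P = "{\<pi>. \<pi> permutes {..<length s}}"
  have fin: "finite ?P" by (simp add: finite_permutations)
  have fin': "finite {\<pi>. \<pi> permutes {..<length s} \<and> Q \<pi>}" for Q
    by (rule finite_subset[OF _ fin]) auto
  let ?S = "(\<lambda>\<pi>. permute_list \<pi> s) ` ?P"
  have sub: "{u. orient s u \<noteq> (0::'k)} \<subseteq> ?S"
  proof
    fix u assume "u \<in> {u. orient s u \<noteq> (0::'k)}"
    then have "orient s u \<noteq> (0::'k)" by simp
    then obtain \<pi> where "\<pi> \<in> {\<pi>. \<pi> permutes {..<length s} \<and> permute_list \<pi> s = u}"
      unfolding orient_def by (rule sum.not_neutral_contains_not_neutral)
    then show "u \<in> ?S" by auto
  qed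
  have "Sum_any (\<lambda>u. if map \<rho> u = t then orient s u * orient a b else (0::'k))
      = (\<Sum>u\<in>?S. if map \<rho> u = t then orient s u * orient a b else 0)"
    using sub fin by (intro Sum_any.expand_superset) auto
  also have "\<dots> = (\<Sum>u\<in>?S. \<Sum>\<pi> | \<pi> \<in> ?P \<and> permute_list \<pi> s = u.
      if map \<rho> (permute_list \<pi> s) = t then of_int (sign \<pi>) * orient a b else 0)"
    by (intro sum.cong refl) (auto simp: orient_def sum_distrib_right)
  also have "\<dots> = (\<Sum>\<pi>\<in>?P. if map \<rho> (permute_list \<pi> s) = t then of_int (sign \<pi>) * orient a b else 0)"
    using fin by (intro sum.group) auto
  also have "\<dots> = (\<Sum>\<pi> | \<pi> permutes {..<length s} \<and> map \<rho> (permute_list \<pi> s) = t. of_int (sign \<pi>) * orient a b)"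
    using fin by (subst sum.inter_filter[symmetric]) auto
  also have "\<dots> = orient (map \<rho> s) t * orient a b"
    unfolding orient_def sum_distrib_right
    by (intro sum.cong) (auto simp: permute_list_map)
  finally have *: "Sum_any (\<lambda>u. if map \<rho> u = t then orient s u * orient a b else (0::'k))
      = orient (map \<rho> s) t * orient a b" .
  have d: "distinct t \<longleftrightarrow> distinct (map \<rho> s)" if "orient (map \<rho> s) t \<noteq> (0::'k)"
    using orient_permuted[OF that] by (metis mset_eq_imp_distinct_iff)
  show "push \<rho> (generator s a) x = (if distinct (map \<rho> s) then generator (map \<rho> s) a else (0 :: ('v, 'k) chain)) x"
      proof (cases "orient (map \<rho> s) t = (0::'k)")
    case True
    then show ?thesis using * by (cases "distinct t") (auto simp: push_def generator_def x)
  next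
    case False
    from d[OF False] * show ?thesis by (cases "distinct t") (auto simp: push_def generator_def x)
  qed
qed


section \<open>Spectral sequences of persistence modules\<close>

text \<open>The data of a spectral sequence of persistence modules over \<open>'k\<close>. The arguments are the
  page \<open>n\<close>, the bidegree \<open>p\<close>, \<open>q\<close> and the filtration parameter \<open>r\<close>;
  \<open>transition E n p q r s\<close> is the structure map from \<open>r\<close> to \<open>s \<ge> r\<close>, and
  \<open>to_succ E n p q r\<close> is the surjection from the kernel of the differential of page \<open>n\<close> onto
  page \<open>n + 1\<close> that induces the isomorphism with the homology of page \<open>n\<close>.\<close>

record ('k, 'e) spectral_sequence =
  page :: "nat \<Rightarrow> int \<Rightarrow> int \<Rightarrow> real \<Rightarrow> 'e set"
  zero_class :: "nat \<Rightarrow> int \<Rightarrow> int \<Rightarrow> real \<Rightarrow> 'e"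
  add_class :: "nat \<Rightarrow> int \<Rightarrow> int \<Rightarrow> real \<Rightarrow> 'e \<Rightarrow> 'e \<Rightarrow> 'e"
  scale_class :: "nat \<Rightarrow> int \<Rightarrow> int \<Rightarrow> real \<Rightarrow> 'k \<Rightarrow> 'e \<Rightarrow> 'e"
  transition :: "nat \<Rightarrow> int \<Rightarrow> int \<Rightarrow> real \<Rightarrow> real \<Rightarrow> 'e \<Rightarrow> 'e"
  page_diff :: "nat \<Rightarrow> int \<Rightarrow> int \<Rightarrow> real \<Rightarrow> 'e \<Rightarrow> 'e"
  to_succ :: "nat \<Rightarrow> int \<Rightarrow> int \<Rightarrow> real \<Rightarrow> 'e \<Rightarrow> 'e"

type_synonym 'e page_maps = "nat \<Rightarrow> int \<Rightarrow> int \<Rightarrow> real \<Rightarrow> 'e \<Rightarrow> 'e"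

text \<open>A \<open>k\<close>-morphism: a morphism of spectral sequences defined on the pages \<open>n \<ge> k\<close>.\<close>

definition is_morphism_from :: "nat \<Rightarrow> ('k, 'e) spectral_sequence \<Rightarrow>
    ('k, 'e) spectral_sequence \<Rightarrow> 'e page_maps \<Rightarrow> bool" where
  "is_morphism_from k E E' f \<longleftrightarrow> (\<forall>n\<ge>k. \<forall>p q r. \<forall>x\<in>page E n p q r.
      f n p q r x \<in> page E' n p q r \<and>
      (\<forall>y\<in>page E n p q r.
         f n p q r (add_class E n p q r x y) = add_class E' n p q r (f n p q r x) (f n p q r y)) \<and>
      (\<forall>a. f n p q r (scale_class E n p q r a x) = scale_class E' n p q r a (f n p q r x)) \<and>
      (\<forall>s\<ge>r. f n p q s (transition E n p q r s x) = transition E' n p q r s (f n p q r x)) \<and>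
      f n (p - int n) (q + int n - 1) r (page_diff E n p q r x) = page_diff E' n p q r (f n p q r x) \<and>
      (page_diff E n p q r x = zero_class E n (p - int n) (q + int n - 1) r \<longrightarrow>
         f (Suc n) p q r (to_succ E n p q r x) = to_succ E' n p q r (f n p q r x)))"

definition restrict_pages :: "nat \<Rightarrow> 'e page_maps \<Rightarrow> 'e page_maps" where
  "restrict_pages k f = (\<lambda>n. if n \<ge> k then f n else undefined)"


subsection \<open>The Mayer-Vietoris spectral sequence\<close>

text \<open>\<open>tot_filtration U r p m\<close> is \<open>F\<^sub>p T\<^sub>m\<close>, the direct sum of the \<open>C\<^sub>i\<^sub>,\<^sub>j\<close> with
  \<open>i + j = m\<close> and \<open>i \<le> p\<close>. The pages are
  \<open>E\<^sup>n\<^sub>p\<^sub>,\<^sub>q = Z\<^sup>n\<^sub>p\<^sub>,\<^sub>q / (Z\<^sup>n\<^sup>-\<^sup>1\<^sub>p\<^sub>-\<^sub>1\<^sub>,\<^sub>q\<^sub>+\<^sub>1 + D Z\<^sup>n\<^sup>-\<^sup>1\<^sub>p\<^sub>+\<^sub>n\<^sub>-\<^sub>1\<^sub>,\<^sub>q\<^sub>-\<^sub>n\<^sub>+\<^sub>2)\<close>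
  with \<open>Z\<^sup>n\<^sub>p\<^sub>,\<^sub>q = {c \<in> F\<^sub>p T\<^sub>p\<^sub>+\<^sub>q. D c \<in> F\<^sub>p\<^sub>-\<^sub>n T\<^sub>p\<^sub>+\<^sub>q\<^sub>-\<^sub>1}\<close>.\<close>

definition tot_filtration ::
    "'v filtered set \<Rightarrow> real \<Rightarrow> int \<Rightarrow> int \<Rightarrow> ('v, 'k::field) chain set" where
  "tot_filtration U r p m = {c \<in> tot_chains U r.
     \<forall>x. c x \<noteq> 0 \<longrightarrow> fst (bidegree x) + snd (bidegree x) = m \<and> fst (bidegree x) \<le> p}"

lemma sum_fun_apply: "(\<Sum>i\<in>I. f i) x = (\<Sum>i\<in>I. f i x :: 'b::comm_monoid_add)"
  by (induction I rule: infinite_finite_induct) auto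

lemma zero_in_tot_chains: "0 \<in> tot_chains U r"
  by (simp add: tot_chains_def alternating_def)

lemma add_in_tot_chains:
  assumes "c \<in> tot_chains U r" "d \<in> tot_chains U r"
  shows "c + d \<in> tot_chains U r"
proof -
  have "{x. (c + d) x \<noteq> 0} \<subseteq> {x. c x \<noteq> 0} \<union> {x. d x \<noteq> 0}"
    by auto
  then have "finite {x. (c + d) x \<noteq> 0}"
    by (rule finite_subset) (use assms in \<open>simp add: tot_chains_def\<close>)
  moreover have "c (s, a) \<noteq> 0 \<or> d (s, a) \<noteq> 0" if "(c + d) (s, a) \<noteq> 0" for s a
    using that by auto
  ultimately show ?thesis
    using assms unfolding tot_chains_def alternating_def mem_Collect_eq
    by (auto simp: distrib_left; blast)
qed

lemma sum_in_tot_chains: "(\<And>i. i \<in> I \<Longrightarrow> f i \<in> tot_chains U r) \<Longrightarrow> sum f I \<in> tot_chains U r"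
  by (induction I rule: infinite_finite_induct) (auto intro: zero_in_tot_chains add_in_tot_chains)

lemma component_in_tot_chains:
  assumes "c \<in> tot_chains U r"
  shows "(\<lambda>x. if bidegree x = d then c x else 0) \<in> tot_chains U r"
proof -
  have "finite {x. (if bidegree x = d then c x else 0) \<noteq> 0}"
    by (rule finite_subset[of _ "{x. c x \<noteq> 0}"]) (use assms in \<open>auto simp: tot_chains_def\<close>)
  then show ?thesis
    using assms by (simp add: tot_chains_def alternating_def bidegree_def)
qed

theorem tot_filtration_eq_sums:
  "(tot_filtration U r p m :: ('v, 'k::field) chain set) =
     {\<Sum>i\<in>{0..p}. f i | f. \<forall>i. f i \<in> double_complex U r i (m - i)}"
proof (intro equalityI subsetI)
  fix c :: "('v, 'k) chain"
  assume c: "c \<in> tot_filtration U r p m"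
  define f where "f i = (\<lambda>x. if bidegree x = (i, m - i) then c x else 0)" for i
  have "c x = (\<Sum>i\<in>{0..p}. f i x)" for x
  proof (cases "c x = 0")
    case True
    then have "f i x = 0" for i by (simp add: f_def)
    with True show ?thesis by simp
  next
    case False
    with c have x: "fst (bidegree x) + snd (bidegree x) = m" "fst (bidegree x) \<le> p"
      unfolding tot_filtration_def by blast+
    obtain s a where sa: "x = (s, a)" by (cases x)
    have "set s \<noteq> {}"
      using False c by (auto simp: sa tot_filtration_def tot_chains_def nerve_def)
    then have "fst (bidegree x) \<ge> 0"
      by (cases s) (auto simp: sa bidegree_def)
    moreover have "f i x = (if i = fst (bidegree x) then c x else 0)" for i
      using x(1) by (auto simp: f_def prod_eq_iff)
    ultimately show ?thesis using x(2) by simp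
  qed
  then have "c = (\<Sum>i\<in>{0..p}. f i)"
    by (simp add: fun_eq_iff sum_fun_apply)
  moreover have "f i \<in> double_complex U r i (m - i)" for i
    using component_in_tot_chains[of c U r "(i, m - i)"] c
    by (auto simp: double_complex_def tot_filtration_def f_def)
  ultimately show "c \<in> {\<Sum>i\<in>{0..p}. f i | f. \<forall>i. f i \<in> double_complex U r i (m - i)}"
    by blast
next
  fix c :: "('v, 'k) chain"
  assume "c \<in> {\<Sum>i\<in>{0..p}. f i | f. \<forall>i. f i \<in> double_complex U r i (m - i)}"
  then obtain f where c: "c = (\<Sum>i\<in>{0..p}. f i)"
    and f: "\<And>i. f i \<in> double_complex U r i (m - i)" by blast
  have "c \<in> tot_chains U r"
    unfolding c using f by (intro sum_in_tot_chains) (auto simp: double_complex_def)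
  moreover have "fst (bidegree x) + snd (bidegree x) = m \<and> fst (bidegree x) \<le> p" if "c x \<noteq> 0" for x
  proof -
    from that have "(\<Sum>i\<in>{0..p}. f i x) \<noteq> 0" by (simp add: c sum_fun_apply)
    then obtain i where "i \<in> {0..p}" "f i x \<noteq> 0"
      by (rule sum.not_neutral_contains_not_neutral)
    moreover from f[of i] \<open>f i x \<noteq> 0\<close> have "bidegree x = (i, m - i)"
      unfolding double_complex_def by blast
    ultimately show ?thesis by simp
  qed
  ultimately show "c \<in> tot_filtration U r p m" by (simp add: tot_filtration_def)
qed

definition ss_cycles ::
    "'v filtered set \<Rightarrow> real \<Rightarrow> int \<Rightarrow> int \<Rightarrow> int \<Rightarrow> ('v, 'k::field) chain set" where
  "ss_cycles U r n p q =
     {c \<in> tot_filtration U r p (p + q). total_diff c \<in> tot_filtration U r (p - n) (p + q - 1)}"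

definition ss_bounds ::
    "'v filtered set \<Rightarrow> real \<Rightarrow> int \<Rightarrow> int \<Rightarrow> int \<Rightarrow> ('v, 'k::field) chain set" where
  "ss_bounds U r n p q =
     {b + total_diff c | b c. b \<in> ss_cycles U r (n - 1) (p - 1) (q + 1) \<and>
        c \<in> ss_cycles U r (n - 1) (p + n - 1) (q - n + 2)}"

definition ss_rel :: "'v filtered set \<Rightarrow> real \<Rightarrow> nat \<Rightarrow> int \<Rightarrow> int \<Rightarrow>
    (('v, 'k::field) chain \<times> ('v, 'k) chain) set" where
  "ss_rel U r n p q = {(x, y). x \<in> ss_cycles U r (int n) p q \<and> y \<in> ss_cycles U r (int n) p q \<and>
     x - y \<in> ss_bounds U r (int n) p q}"

text \<open>Elements of a page are classes of chains. For a set \<open>S\<close> of equivalent representatives,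
  \<open>ss_rel U r n p q `` S\<close> is the class they represent.\<close>

definition mv_spectral_sequence ::
    "'v filtered set \<Rightarrow> ('k::field, ('v, 'k) chain set) spectral_sequence" where
  "mv_spectral_sequence U = \<lparr>
     page = (\<lambda>n p q r. ss_cycles U r (int n) p q // ss_rel U r n p q),
     zero_class = (\<lambda>n p q r. ss_rel U r n p q `` {0}),
     add_class = (\<lambda>n p q r A B. ss_rel U r n p q `` {x + y | x y. x \<in> A \<and> y \<in> B}),
     scale_class = (\<lambda>n p q r k A. ss_rel U r n p q `` ((\<lambda>c x. k * c x) ` A)),
     transition = (\<lambda>n p q r s A. ss_rel U s n p q `` A),
     page_diff = (\<lambda>n p q r A. ss_rel U r n (p - int n) (q + int n - 1) `` (total_diff ` A)),
     to_succ = (\<lambda>n p q r A.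
       ss_rel U r (Suc n) p q `` (A \<inter> ss_cycles U r (int (Suc n)) p q)) \<rparr>"

definition refinement_morphism :: "'v filtered set \<Rightarrow> 'v filtered set \<Rightarrow>
    ('v filtered \<Rightarrow> 'v filtered) \<Rightarrow> ('v, 'k::field) chain set page_maps" where
  "refinement_morphism V U \<rho> = (\<lambda>n p q r.
     \<lambda>A\<in>page (mv_spectral_sequence V) n p q r. ss_rel U r n p q `` (push \<rho> ` A))"

definition refinement_2morphism :: "'v filtered set \<Rightarrow> 'v filtered set \<Rightarrow>
    ('v filtered \<Rightarrow> 'v filtered) \<Rightarrow> ('v, 'k::field) chain set page_maps" where
  "refinement_2morphism V U \<rho> = restrict_pages 2 (refinement_morphism V U \<rho>)"

end

theory Submission
  imports Defs
begin

text \<open>Two refinement maps \<open>\<rho>\<close> and \<open>\<tau>\<close> are contiguous: \<open>\<rho> \<sigma> \<union> \<tau> \<sigma>\<close> is a simplex of \<open>nerve U\<close> for every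
  simplex \<open>\<sigma>\<close> of \<open>nerve V\<close>, and its intersection contains that of \<open>\<sigma>\<close>. If they differ at a single
  vertex, the induced maps of double complexes are therefore related by a chain homotopy \<open>h\<close> of
  bidegree \<open>(1, 0)\<close>. For a cycle \<open>x\<close> of page \<open>n\<close> this gives \<open>\<tau> x - \<rho> x = D h x + h D x\<close>, where
  \<open>h D x\<close> has filtration degree at most \<open>p - n + 1\<close> and \<open>h x\<close> at most \<open>p + 1\<close>; for \<open>n \<ge> 2\<close> this is
  a boundary of page \<open>n\<close>. Since \<open>x\<close> involves only finitely many vertices, changing \<open>\<rho>\<close> into \<open>\<tau>\<close> one
  vertex at a time settles the general case.\<close>

section \<open>Ordered simplices and their signs\<close>

text \<open>Vertices are changed one at a time because the usual prism operator between two
  arbitrary vertex maps depends on a total order of the vertices, and oriented chains carry none.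
  For maps that differ only at \<open>A\<close>, with new value \<open>Q\<close>, the prism over
  \<open>A # s\<close> has just one piece without a repeated vertex in general position,
  \<open>\<rho> A # Q # map \<rho> s\<close>; every other piece repeats the image of a vertex of
  \<open>s\<close>.

  The operator \<open>h\<close> leaves the simplex of the intersection alone and raises
  \<open>p\<close> by one, so the sign \<open>(- 1) ^ p\<close> of the vertical differential makes
  the two anticommute; hence \<open>h\<close> is a homotopy for the total differential and not only
  for the Cech part. On page 1 the term \<open>h D x\<close> would only be known to lie in
  filtration degree \<open>p\<close>, the degree of \<open>x\<close> itself; one page later it drops
  below \<open>p\<close>.

  Vertex maps may collapse simplices. \<open>orient\<close> vanishes on lists with repetitions, so
  \<open>generator\<close> is meaningful for every list, and the Cech formula on generators is
  extended to all lists. Collapsed simplices and degenerate prisms are then covered by the same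
  computation.\<close>

lemma mset_permute_list_obtain:
  assumes "mset t = mset s"
  obtains \<pi> where "\<pi> permutes {..<length s}" "t = permute_list \<pi> s"
  using mset_eq_permutation[OF assms] by metis

text \<open>Inverting permutations matches the two index sets and preserves signs. Through this
  symmetry, \<open>alternating_orient\<close> becomes available for the first argument too.\<close>

lemma orient_commute: "orient s t = (orient t s :: 'k::field)"
proof (cases "length s = length t")
  case True
  have inv: "permute_list (inv \<pi>) v = u"
    if "\<pi> permutes {..<length u}" "permute_list \<pi> u = v" for \<pi> and u v :: "'a list"
    using permute_list_compose[of "inv \<pi>" u \<pi>] permutes_inv[OF that(1)] that
      permutes_inv_o(1)[OF that(1)] by simp
  show ?thesis
    unfolding orient_def
  proof (rule sum.reindex_bij_witness[where i = inv and j = inv])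
    fix \<pi> assume "\<pi> \<in> {\<pi>. \<pi> permutes {..<length s} \<and> permute_list \<pi> s = t}"
    then show "inv \<pi> \<in> {\<pi>. \<pi> permutes {..<length t} \<and> permute_list \<pi> t = s}"
      "inv (inv \<pi>) = \<pi>" "of_int (sign (inv \<pi>)) = (of_int (sign \<pi>) :: 'k)"
      using inv[of \<pi> s t] True permutes_imp_permutation[OF finite_lessThan, of \<pi> "length s"]
      by (auto simp: permutes_inv permutes_inv_inv sign_inverse)
  next
    fix \<pi> assume "\<pi> \<in> {\<pi>. \<pi> permutes {..<length t} \<and> permute_list \<pi> t = s}"
    then show "inv \<pi> \<in> {\<pi>. \<pi> permutes {..<length s} \<and> permute_list \<pi> s = t}"
      "inv (inv \<pi>) = \<pi>"
      using inv[of \<pi> t s] True by (auto simp: permutes_inv permutes_inv_inv)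
  qed
next
  case False
  then show ?thesis
    using orient_length[of s t, where ?'k = 'k] orient_length[of t s, where ?'k = 'k] by metis
qed

lemma orient_permute_list:
  assumes "\<pi> permutes {..<length s}"
  shows "orient (permute_list \<pi> s) t = of_int (sign \<pi>) * (orient s t :: 'k::field)"
  using alternating_orient[of t] assms
  unfolding alternating_def by (metis orient_commute)

text \<open>The signs cancel in pairs over the integers, hence also in characteristic 2.\<close>

lemma orient_not_distinct:
  assumes "\<not> distinct s"
  shows "orient s t = (0 :: 'k::field)"
proof -
  obtain i j where ij: "i < length s" "j < length s" "i \<noteq> j" "s ! i = s ! j"
    using assms by (auto simp: distinct_conv_nth)
  let ?\<tau> = "Transposition.transpose i j"
  have \<tau>: "?\<tau> permutes {..<length s}"
    using ij by (intro permutes_transposeI)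
  have fix_s: "permute_list ?\<tau> s = s"
    using ij permute_list_nth[OF \<tau>]
    by (intro nth_equalityI) (auto simp: Transposition.transpose_def)
  let ?P = "{\<pi>. \<pi> permutes {..<length s} \<and> permute_list \<pi> s = t}"
  have "(\<Sum>\<pi>\<in>?P. sign \<pi>) = (\<Sum>\<pi>\<in>?P. sign (?\<tau> \<circ> \<pi>))"
    using \<tau> fix_s permutes_compose
    by (intro sum.reindex_bij_witness[where i = "\<lambda>\<pi>. ?\<tau> \<circ> \<pi>" and j = "\<lambda>\<pi>. ?\<tau> \<circ> \<pi>"])
      (auto simp: permute_list_compose comp_assoc[symmetric])
  also have "\<dots> = (\<Sum>\<pi>\<in>?P. - sign \<pi>)"
    using \<tau> ij(3) permutes_imp_permutation[OF finite_lessThan]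
    by (intro sum.cong refl, subst sign_compose) (auto simp: sign_swap_id)
  finally have "(\<Sum>\<pi>\<in>?P. sign \<pi>) = 0"
    by (simp add: sum_negf)
  then show ?thesis
    unfolding orient_def of_int_sum[symmetric] by simp
qed

text \<open>The permutations counted on the left are grouped by the list \<open>u\<close> into which
  they put \<open>s\<close>. As \<open>f\<close> may identify entries, several \<open>u\<close> can
  contribute.\<close>

lemma orient_map:
  "orient (map f s) t = Sum_any (\<lambda>u. if map f u = t then orient s u else (0::'k::field))"
proof -
  let ?P = "{\<pi>. \<pi> permutes {..<length s}}"
  let ?S = "(\<lambda>\<pi>. permute_list \<pi> s) ` ?P"
  have fin: "finite ?P" by (simp add: finite_permutations)
  have "u \<in> ?S" if "orient s u \<noteq> (0::'k)" for u
    using orient_permuted[OF that] by (auto elim: mset_permute_list_obtain)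
  then have "Sum_any (\<lambda>u. if map f u = t then orient s u else (0::'k))
      = (\<Sum>u\<in>?S. if map f u = t then orient s u else 0)"
    using fin by (intro Sum_any.expand_superset) auto
  also have "\<dots> = (\<Sum>u\<in>?S. \<Sum>\<pi> | \<pi> \<in> ?P \<and> permute_list \<pi> s = u.
      if map f (permute_list \<pi> s) = t then of_int (sign \<pi>) else 0)"
    by (intro sum.cong refl) (auto simp: orient_def)
  also have "\<dots> = (\<Sum>\<pi>\<in>?P. if map f (permute_list \<pi> s) = t then of_int (sign \<pi>) else 0)"
    using fin by (intro sum.group) auto
  also have "\<dots> = orient (map f s) t"
    using fin unfolding orient_def
    by (subst sum.inter_filter[symmetric]) (auto simp: permute_list_map intro!: sum.cong)
  finally show ?thesis ..
qed

text \<open>\<open>s\<close> is the image of the distinct list of its indices, and \<open>orient_map\<close> transports the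
  expansion of the latter.\<close>

lemma Sum_any_orient_Cons_general:
  "Sum_any (\<lambda>x. orient s (x # t)) = (\<Sum>i<length s. (- 1) ^ i * orient (omit i s) t :: 'k::field)"
proof -
  define f where "f i = s ! i" for i
  define ns where "ns = [0..<length s]"
  have s: "s = map f ns"
    by (rule nth_equalityI) (simp_all add: f_def ns_def)
  have ns: "distinct ns" "length ns = length s" by (simp_all add: ns_def)
  let ?g = "\<lambda>u. if map f u = t then Sum_any (\<lambda>y. orient ns (y # u)) else (0::'k)"
  let ?Y = "set ns"
  \<comment> \<open>A finite set that contains the tails of all orderings of \<open>ns\<close> and
    the orderings of all its faces.\<close>
  let ?W = "{u. set u \<subseteq> set ns \<and> length u \<le> length ns}"
  let ?X = "f ` ?Y"
  have W: "finite ?W" by (rule finite_lists_length_le) simp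
  have z: "orient ns v = (0::'k)" if "\<not> (set v \<subseteq> ?Y \<and> length v = length ns)" for v
    using that orient_permuted[of ns v, where ?'k = 'k] by (metis order_refl mset_eq_length mset_eq_setD)
  have "Sum_any (\<lambda>x. orient s (x # t)) = (\<Sum>x\<in>?X. orient s (x # t) :: 'k)"
  proof (rule Sum_any.expand_superset)
    show "{x. orient s (x # t) \<noteq> (0::'k)} \<subseteq> f ` ?Y"
      using orient_permuted[of s _, where ?'k = 'k] mset_eq_setD[of "_ # t" s]
      by (fastforce simp: s)
  qed simp
  also have "\<dots> = (\<Sum>x\<in>?X. \<Sum>y\<in>?Y. \<Sum>u\<in>?W. if f y = x \<and> map f u = t then orient ns (y # u) else 0)"
  proof (intro sum.cong refl)
    fix x
    have "orient s (x # t) = Sum_any (\<lambda>v. if map f v = x # t then orient ns v else (0::'k))"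
      unfolding s by (rule orient_map)
    also have "\<dots> = (\<Sum>v\<in>(\<lambda>(y, u). y # u) ` (?Y \<times> ?W). if map f v = x # t then orient ns v else (0::'k))"
    proof (rule Sum_any.expand_superset)
      show "{v. (if map f v = x # t then orient ns v else (0::'k)) \<noteq> 0} \<subseteq> (\<lambda>(y, u). y # u) ` (?Y \<times> ?W)"
      proof
        fix v assume "v \<in> {v. (if map f v = x # t then orient ns v else (0::'k)) \<noteq> 0}"
        then have v: "map f v = x # t" "orient ns v \<noteq> (0::'k)" by (auto split: if_splits)
        then obtain y u where "v = y # u" by auto
        with z[of v] v(2) show "v \<in> (\<lambda>(y, u). y # u) ` (?Y \<times> ?W)" by force
      qed
    qed (use W in simp)
    also have "\<dots> = (\<Sum>(y,u)\<in>?Y \<times> ?W. if f y = x \<and> map f u = t then orient ns (y # u) else 0)"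
      by (subst sum.reindex) (auto simp: inj_on_def intro!: sum.cong)
    finally show "orient s (x # t) = (\<Sum>y\<in>?Y. \<Sum>u\<in>?W. if f y = x \<and> map f u = t then orient ns (y # u) else (0::'k))"
      by (simp add: sum.cartesian_product)
  qed
  \<comment> \<open>With \<open>x\<close> innermost its sum collapses to the single term
    \<open>x = f y\<close>.\<close>
  also have "\<dots> = (\<Sum>y\<in>?Y. \<Sum>u\<in>?W. \<Sum>x\<in>?X. if f y = x \<and> map f u = t then orient ns (y # u) else 0)"
    by (subst sum.swap, intro sum.cong refl, rule sum.swap)
  also have "\<dots> = (\<Sum>y\<in>?Y. \<Sum>u\<in>?W. if map f u = t then orient ns (y # u) else 0)"
  proof (intro sum.cong refl)
    fix y u assume "y \<in> ?Y"
    then show "(\<Sum>x\<in>?X. if f y = x \<and> map f u = t then orient ns (y # u) else 0)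
      = (if map f u = t then orient ns (y # u) else (0::'k))"
      by (cases "map f u = t") simp_all
  qed
  also have "\<dots> = (\<Sum>u\<in>?W. ?g u)"
  proof (subst sum.swap, intro sum.cong refl)
    fix u
    have "Sum_any (\<lambda>y. orient ns (y # u)) = (\<Sum>y\<in>?Y. orient ns (y # u) :: 'k)"
      using z[of "_ # u"] by (intro Sum_any.expand_superset) auto
    then show "(\<Sum>y\<in>?Y. if map f u = t then orient ns (y # u) else 0) = ?g u" by simp
  qed
  also have "\<dots> = (\<Sum>u\<in>?W. \<Sum>i<length s. (-1) ^ i * (if map f u = t then orient (omit i ns) u else 0))"
    by (intro sum.cong refl) (simp add: Sum_any_orient_Cons ns)
  also have "\<dots> = (\<Sum>i<length s. (-1) ^ i * (\<Sum>u\<in>?W. if map f u = t then orient (omit i ns) u else 0))"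
    by (subst sum.swap) (simp add: sum_distrib_left)
  also have "\<dots> = (\<Sum>i<length s. (-1) ^ i * orient (omit i s) t)"
  proof (intro sum.cong refl arg_cong2[where f = "(*)"])
    fix i
    have "(\<Sum>u\<in>?W. if map f u = t then orient (omit i ns) u else 0)
        = Sum_any (\<lambda>u. if map f u = t then orient (omit i ns) u else (0::'k))"
    proof (rule Sum_any.expand_superset[symmetric])
      have "u \<in> ?W" if "orient (omit i ns) u \<noteq> (0::'k)" for u
        using orient_permuted[OF that, THEN mset_eq_setD] orient_length[OF that]
        by (auto dest: in_set_takeD in_set_dropD)
      then show "{u. (if map f u = t then orient (omit i ns) u else (0::'k)) \<noteq> 0} \<subseteq> ?W"
        by auto
    qed (rule W)
    also have "\<dots> = orient (omit i s) t"
      unfolding orient_map[symmetric] s by (simp add: take_map drop_map)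
    finally show "(\<Sum>u\<in>?W. if map f u = t then orient (omit i ns) u else 0) = (orient (omit i s) t :: 'k)" .
  qed
  finally show ?thesis .
qed

section \<open>Linear operators on chains\<close>

text \<open>For a list with repetitions the left side is zero, and the formula says that the signed
  faces cancel. It can therefore be applied to \<open>map \<rho> s\<close> and to
  \<open>\<rho> A # Q # map \<rho> s\<close>, whose entries may coincide.\<close>

theorem cech_diff_generator_general:
  assumes "length s \<ge> 2"
  shows "cech_diff (generator s a) = (\<lambda>x. \<Sum>i<length s. (- 1) ^ i * generator (omit i s) a x :: 'k::field)"
proof
  fix x :: "'a filtered list \<times> 'a list"
  obtain t b where x: "x = (t, b)" by (cases x)
  have 0: "orient (omit i s) [] = (0::'k)" if "i < length s" for i
  proof (rule ccontr)
    assume "orient (omit i s) [] \<noteq> (0::'k)"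
    from orient_length[OF this] that assms show False by simp
  qed
  have "Sum_any (\<lambda>Y. orient s (Y # t) * orient a b)
      = (\<Sum>i<length s. (- 1) ^ i * (orient (omit i s) t * orient a b) :: 'k)"
    using Sum_any_left_distrib[OF Sum_any_orient_finite[of s t, where ?'k = 'k], of "orient a b"]
      Sum_any_orient_Cons_general[of s t, where ?'k = 'k]
    by (simp add: sum_distrib_right mult.assoc)
  then show "cech_diff (generator s a) x = (\<Sum>i<length s. (- 1) ^ i * generator (omit i s) a x :: 'k)"
    by (auto simp: cech_diff_def generator_def x 0)
qed

text \<open>The complex is not augmented: the empty face of a vertex is discarded by
  \<open>cech_diff\<close>.\<close>

lemma cech_diff_generator_short:
  assumes "length s < 2"
  shows "cech_diff (generator s a) = (0 :: ('v, 'k::field) chain)"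
proof
  fix x :: "'v filtered list \<times> 'v list"
  have "generator s a (Y # t, b) = (0::'k)" if "t \<noteq> []" for Y t b
    using orient_length[of s "Y # t", where ?'k = 'k] assms that by (cases t) (auto simp: generator_def)
  then show "cech_diff (generator s a) x = (0 :: ('v, 'k) chain) x"
    by (auto simp: cech_diff_def split: prod.split)
qed

lemma simplicial_diff_generator_short:
  assumes "length a < 2"
  shows "simplicial_diff (generator s a) = (0 :: ('v, 'k::field) chain)"
proof
  fix x :: "'v filtered list \<times> 'v list"
  have "generator s a (t, y # b) = (0::'k)" if "b \<noteq> []" for y t b
    using orient_length[of a "y # b", where ?'k = 'k] assms that by (cases b) (auto simp: generator_def)
  then show "simplicial_diff (generator s a) x = (0 :: ('v, 'k) chain) x"
    by (auto simp: simplicial_diff_def split: prod.split)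
qed

lemma generator_not_distinct:
  "\<not> distinct s \<Longrightarrow> generator s a = (0 :: ('v, 'k::field) chain)"
  "\<not> distinct a \<Longrightarrow> generator s a = (0 :: ('v, 'k::field) chain)"
  by (auto simp: generator_def orient_not_distinct)

text \<open>A collapsed simplex goes to a generator with repeated vertices, which is already zero;
  this absorbs the case distinction of \<open>push_generator\<close>.\<close>

lemma push_generator_eq: "push \<rho> (generator s a) = (generator (map \<rho> s) a :: ('v, 'k::field) chain)"
  by (simp add: push_generator generator_not_distinct)

lemma generator_permute_list:
  assumes "\<pi> permutes {..<length s}"
  shows "generator (permute_list \<pi> s) a = (\<lambda>x. of_int (sign \<pi>) * (generator s a x :: 'k::field))"
  by (auto simp: generator_def orient_permute_list[OF assms])

section \<open>Finitely supported chains and operators linear on them\<close>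

definition fin_supp :: "('v, 'k::field) chain \<Rightarrow> bool" where
  "fin_supp c \<longleftrightarrow> finite {x. c x \<noteq> 0}"

lemma fin_supp_zero: "fin_supp 0"
  by (simp add: fin_supp_def)

lemma fin_supp_add: "fin_supp c \<Longrightarrow> fin_supp d \<Longrightarrow> fin_supp (c + d)"
  unfolding fin_supp_def by (rule finite_subset[of _ "{x. c x \<noteq> 0} \<union> {x. d x \<noteq> 0}"]) auto

lemma fin_supp_scale: "fin_supp c \<Longrightarrow> fin_supp (\<lambda>x. k * c x)"
  unfolding fin_supp_def by (rule finite_subset[of _ "{x. c x \<noteq> 0}"]) auto

lemma fin_supp_generator: "fin_supp (generator s a :: ('v, 'k::field) chain)"
  unfolding fin_supp_def
proof (rule finite_subset)
  show "{x. generator s a x \<noteq> (0::'k)} \<subseteq> {t. mset t = mset s} \<times> {b. mset b = mset a}"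
    using orient_permuted[of s, where ?'k = 'k] orient_permuted[of a, where ?'k = 'k]
    by (auto simp: generator_def)
qed (intro finite_cartesian_product mset_eq_finite)

lemma tot_chains_fin_supp: "c \<in> tot_chains U r \<Longrightarrow> fin_supp c"
  by (simp add: tot_chains_def fin_supp_def)

text \<open>Linearity is asked on finitely supported chains only, because \<open>Sum_any\<close>
  returns 0 on infinite supports and is not additive there. Preservation of finite support is
  included so that operators can be composed.\<close>

definition linear_op :: "(('v, 'k::field) chain \<Rightarrow> ('v, 'k) chain) \<Rightarrow> bool" where
  "linear_op L \<longleftrightarrow> (\<forall>c. fin_supp c \<longrightarrow> fin_supp (L c) \<and> (\<forall>k. L (\<lambda>x. k * c x) = (\<lambda>x. k * L c x)) \<and>
     (\<forall>d. fin_supp d \<longrightarrow> L (c + d) = L c + L d))"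

lemma linear_op_fin_supp: "linear_op L \<Longrightarrow> fin_supp c \<Longrightarrow> fin_supp (L c)"
  and linear_op_scale: "linear_op L \<Longrightarrow> fin_supp c \<Longrightarrow> L (\<lambda>x. k * c x) = (\<lambda>x. k * L c x)"
  and linear_op_add: "linear_op L \<Longrightarrow> fin_supp c \<Longrightarrow> fin_supp d \<Longrightarrow> L (c + d) = L c + L d"
  by (simp_all add: linear_op_def)

lemma linear_op_zero: "linear_op L \<Longrightarrow> L 0 = 0"
  using linear_op_scale[OF _ fin_supp_zero, of L 0] by (simp add: zero_fun_def)

lemma minus_chain_eq: "c - d = c + (\<lambda>x. - 1 * d x)" for c d :: "('v, 'k::field) chain"
  by (simp add: fun_eq_iff)

lemma fin_supp_diff: "fin_supp c \<Longrightarrow> fin_supp d \<Longrightarrow> fin_supp (c - d)"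
  unfolding minus_chain_eq by (intro fin_supp_add fin_supp_scale)

lemma linear_op_diff: "linear_op L \<Longrightarrow> fin_supp c \<Longrightarrow> fin_supp d \<Longrightarrow> L (c - d) = L c - L d"
  unfolding minus_chain_eq by (simp only: linear_op_add fin_supp_scale linear_op_scale)

lemma linear_op_comp: "linear_op L \<Longrightarrow> linear_op M \<Longrightarrow> linear_op (\<lambda>c. L (M c))"
  unfolding linear_op_def by simp

lemma linear_op_plus: "linear_op L \<Longrightarrow> linear_op M \<Longrightarrow> linear_op (\<lambda>c. L c + M c)"
  unfolding linear_op_def by (simp add: fin_supp_add fun_eq_iff algebra_simps)

lemma linear_op_minus: "linear_op L \<Longrightarrow> linear_op M \<Longrightarrow> linear_op (\<lambda>c. L c - M c)"
  unfolding linear_op_def by (simp add: fin_supp_diff fun_eq_iff algebra_simps)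

text \<open>Finite support of the sum is part of the claim because the induction step uses it to
  split off one term by additivity.\<close>

lemma linear_op_sum:
  fixes L :: "('v, 'k::field) chain \<Rightarrow> ('v, 'k) chain"
  assumes "linear_op L" "finite I" "\<And>i. i \<in> I \<Longrightarrow> fin_supp (f i)"
  shows "fin_supp (\<lambda>x. \<Sum>i\<in>I. k i * f i x) \<and>
    L (\<lambda>x. \<Sum>i\<in>I. k i * f i x) = (\<lambda>x. \<Sum>i\<in>I. k i * L (f i) x)"
  using assms(2,3)
proof (induction I rule: finite_induct)
  case empty
  then show ?case using linear_op_zero[OF assms(1)] fin_supp_zero by (simp add: zero_fun_def)
next
  case (insert j I)
  have *: "(\<lambda>x. \<Sum>i\<in>insert j I. k i * g i x) = (\<lambda>x. k j * g j x) + (\<lambda>x. \<Sum>i\<in>I. k i * g i x)"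
    for g :: "_ \<Rightarrow> ('v, 'k) chain"
    using insert.hyps by (simp add: fun_eq_iff)
  show ?case
    unfolding *[of f] *[of "\<lambda>i. L (f i)"] using insert.IH insert.prems
    by (simp only: insert_iff simp_thms)
      (simp only: fin_supp_add fin_supp_scale linear_op_add[OF assms(1)] linear_op_scale[OF assms(1)] simp_thms)
qed

text \<open>The common shape of \<open>cech_diff\<close>, \<open>simplicial_diff\<close>,
  \<open>push\<close> and \<open>cone_homotopy\<close>: a weighted sum of values of
  \<open>c\<close>. The hypothesis says that each value \<open>c y\<close> is used by finitely many
  pairs \<open>(x, i)\<close>, which makes both the inner sums and the support of the result
  finite.\<close>

lemma linear_op_Sum_any:
  fixes g :: "'v filtered list \<times> 'v list \<Rightarrow> 'i \<Rightarrow> 'v filtered list \<times> 'v list"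
    and w :: "'v filtered list \<times> 'v list \<Rightarrow> 'i \<Rightarrow> 'k::field"
  assumes "\<And>y. finite {(x, i). g x i = y \<and> w x i \<noteq> 0}"
  shows "linear_op (\<lambda>c x. Sum_any (\<lambda>i. w x i * c (g x i)))"
proof -
  have fin: "finite {(x, i). w x i * c (g x i) \<noteq> 0}" if "fin_supp c" for c :: "('v, 'k) chain"
  proof (rule finite_subset)
    show "{(x, i). w x i * c (g x i) \<noteq> 0} \<subseteq> (\<Union>y\<in>{y. c y \<noteq> 0}. {(x, i). g x i = y \<and> w x i \<noteq> 0})"
      by auto
  qed (use that assms in \<open>auto simp: fin_supp_def\<close>)
  have fin1: "finite {i. w x i * c (g x i) \<noteq> 0}" if "fin_supp c" for c :: "('v, 'k) chain" and x
    using finite_vimageI[OF fin[OF that], of "Pair x"] by (simp add: vimage_def inj_on_def)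
  show ?thesis
    unfolding linear_op_def
  proof (intro allI impI conjI)
    fix c :: "('v, 'k) chain" assume c: "fin_supp c"
    show "fin_supp (\<lambda>x. Sum_any (\<lambda>i. w x i * c (g x i)))"
      unfolding fin_supp_def
    proof (rule finite_subset)
      show "{x. Sum_any (\<lambda>i. w x i * c (g x i)) \<noteq> 0} \<subseteq> fst ` {(x, i). w x i * c (g x i) \<noteq> 0}"
      proof
        fix x assume "x \<in> {x. Sum_any (\<lambda>i. w x i * c (g x i)) \<noteq> 0}"
        then obtain i where "w x i * c (g x i) \<noteq> 0"
          by (auto elim: Sum_any.not_neutral_obtains_not_neutral)
        then show "x \<in> fst ` {(x, i). w x i * c (g x i) \<noteq> 0}" by force
      qed
    qed (intro finite_imageI fin c)
    show "(\<lambda>x. Sum_any (\<lambda>i. w x i * (k * c (g x i)))) = (\<lambda>x. k * Sum_any (\<lambda>i. w x i * c (g x i)))" for k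
      using Sum_any_right_distrib[OF fin1[OF c]] by (simp add: mult.left_commute)
    show "(\<lambda>x. Sum_any (\<lambda>i. w x i * (c + d) (g x i))) =
        (\<lambda>x. Sum_any (\<lambda>i. w x i * c (g x i))) + (\<lambda>x. Sum_any (\<lambda>i. w x i * d (g x i)))"
      if d: "fin_supp d" for d
    proof
      fix x
      show "Sum_any (\<lambda>i. w x i * (c + d) (g x i)) =
        ((\<lambda>x. Sum_any (\<lambda>i. w x i * c (g x i))) + (\<lambda>x. Sum_any (\<lambda>i. w x i * d (g x i)))) x"
        using Sum_any.distrib[OF fin1[OF c] fin1[OF d], of x x] by (simp add: distrib_left)
    qed
  qed
qed

lemma linear_op_cech_diff: "linear_op (cech_diff :: ('v, 'k::field) chain \<Rightarrow> _)"
proof -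
  have "linear_op (\<lambda>(c :: ('v, 'k) chain) x. Sum_any (\<lambda>Y. (if fst x = [] then 0 else 1 :: 'k) * c (Y # fst x, snd x)))"
  proof (rule linear_op_Sum_any[where g = "\<lambda>x Y. (Y # fst x, snd x)" and w = "\<lambda>x _. if fst x = [] then 0 else 1"])
    fix y :: "'v filtered list \<times> 'v list"
    show "finite {(x, Y). (Y # fst x, snd x) = y \<and> (if fst x = [] then 0 else 1 :: 'k) \<noteq> 0}"
      by (rule finite_subset[of _ "{((tl (fst y), snd y), hd (fst y))}"]) auto
  qed
  also have "(\<lambda>(c :: ('v, 'k) chain) x. Sum_any (\<lambda>Y. (if fst x = [] then 0 else 1 :: 'k) * c (Y # fst x, snd x))) = (cech_diff :: ('v, 'k) chain \<Rightarrow> _)"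
    by (intro ext) (simp add: cech_diff_def split: prod.split)
  finally show ?thesis .
qed

lemma linear_op_simplicial_diff: "linear_op (simplicial_diff :: ('v, 'k::field) chain \<Rightarrow> _)"
proof -
  have "linear_op (\<lambda>(c :: ('v, 'k) chain) x. Sum_any (\<lambda>v. (if snd x = [] then 0 else 1 :: 'k) * c (fst x, v # snd x)))"
  proof (rule linear_op_Sum_any[where g = "\<lambda>x v. (fst x, v # snd x)" and w = "\<lambda>x _. if snd x = [] then 0 else 1"])
    fix y :: "'v filtered list \<times> 'v list"
    show "finite {(x, v). (fst x, v # snd x) = y \<and> (if snd x = [] then 0 else 1 :: 'k) \<noteq> 0}"
      by (rule finite_subset[of _ "{((fst y, tl (snd y)), hd (snd y))}"]) auto
  qed
  also have "(\<lambda>(c :: ('v, 'k) chain) x. Sum_any (\<lambda>v. (if snd x = [] then 0 else 1 :: 'k) * c (fst x, v # snd x))) = (simplicial_diff :: ('v, 'k) chain \<Rightarrow> _)"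
    by (intro ext) (simp add: simplicial_diff_def split: prod.split)
  finally show ?thesis .
qed

text \<open>The sign is separated from \<open>vertical_diff\<close> so that linearity follows by
  composition.\<close>

definition column_sign :: "('v, 'k::field) chain \<Rightarrow> ('v, 'k) chain" where
  "column_sign c = (\<lambda>(s, b). (- 1) ^ (length s - 1) * c (s, b))"

lemma vertical_diff_eq: "vertical_diff c = column_sign (simplicial_diff c)"
  by (simp add: vertical_diff_def column_sign_def)

lemma linear_op_column_sign: "linear_op (column_sign :: ('v, 'k::field) chain \<Rightarrow> _)"
  unfolding linear_op_def
proof (intro allI impI conjI)
  show "fin_supp (column_sign c)" if "fin_supp c" for c :: "('v, 'k) chain"
    using that unfolding fin_supp_def
    by (rule rev_finite_subset) (auto simp: column_sign_def)
qed (auto simp: column_sign_def fun_eq_iff algebra_simps)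

lemma linear_op_vertical_diff: "linear_op vertical_diff"
  unfolding vertical_diff_eq[abs_def]
  by (rule linear_op_comp[OF linear_op_column_sign linear_op_simplicial_diff])

lemma linear_op_total_diff: "linear_op total_diff"
  unfolding total_diff_def[abs_def]
  by (rule linear_op_plus[OF linear_op_cech_diff linear_op_vertical_diff])

lemma linear_op_push: "linear_op (push \<rho> :: ('v, 'k::field) chain \<Rightarrow> _)"
proof -
  have "linear_op (\<lambda>(c :: ('v, 'k) chain) x. Sum_any (\<lambda>s. (if map \<rho> s = fst x \<and> distinct (fst x) then 1 else 0 :: 'k) * c (s, snd x)))"
  proof (rule linear_op_Sum_any[where g = "\<lambda>x s. (s, snd x)" and w = "\<lambda>x s. if map \<rho> s = fst x \<and> distinct (fst x) then 1 else 0"])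
    fix y :: "'v filtered list \<times> 'v list"
    show "finite {(x, s). (s, snd x) = y \<and> (if map \<rho> s = fst x \<and> distinct (fst x) then 1 else 0::'k) \<noteq> 0}"
      by (rule finite_subset[of _ "{((map \<rho> (fst y), snd y), fst y)}"]) (auto split: if_splits)
  qed
  also have "(\<lambda>(c :: ('v, 'k) chain) x. Sum_any (\<lambda>s. (if map \<rho> s = fst x \<and> distinct (fst x) then 1 else 0 :: 'k) * c (s, snd x)))
      = (push \<rho> :: ('v, 'k) chain \<Rightarrow> _)"
    by (intro ext, clarsimp simp: push_def, intro arg_cong[of _ _ Sum_any] ext, simp)
  finally show ?thesis .
qed

text \<open>On generators, \<open>(A, s) \<mapsto> (\<rho> A, Q, \<rho> s)\<close> and \<open>s \<mapsto> 0\<close> if \<open>A\<close> is not a vertex of \<open>s\<close>: the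
  prism operator between two vertex maps which differ only at \<open>A\<close>. It needs no total order on the
  vertices. The result does not depend on the ordering of \<open>S\<close> that is chosen by \<open>SOME\<close>.\<close>

definition cone_homotopy :: "'v filtered \<Rightarrow> 'v filtered \<Rightarrow> ('v filtered \<Rightarrow> 'v filtered) \<Rightarrow>
    ('v, 'k::field) chain \<Rightarrow> ('v, 'k) chain" where
  "cone_homotopy A Q \<rho> c = (\<lambda>(t, b). Sum_any (\<lambda>S. if finite S \<and> A \<notin> S
     then orient (\<rho> A # Q # map \<rho> (SOME u. distinct u \<and> set u = S)) t * c (A # (SOME u. distinct u \<and> set u = S), b)
     else 0))"

lemma some_ordering:
  assumes "finite S"
  shows "distinct (SOME u. distinct u \<and> set u = S) \<and> set (SOME u. distinct u \<and> set u = S) = S"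
  by (rule someI_ex) (use finite_distinct_list[OF assms] in blast)

lemma linear_op_cone_homotopy: "linear_op (cone_homotopy A Q \<rho> :: ('v, 'k::field) chain \<Rightarrow> _)"
proof -
  let ?r = "\<lambda>S. SOME u. distinct u \<and> set u = S"
  let ?w = "\<lambda>x S. if finite S \<and> A \<notin> S then orient (\<rho> A # Q # map \<rho> (?r S)) (fst x) else (0 :: 'k)"
  have "linear_op (\<lambda>(c :: ('v, 'k) chain) x. Sum_any (\<lambda>S. ?w x S * c (A # ?r S, snd x)))"
  proof (rule linear_op_Sum_any[where g = "\<lambda>x S. (A # ?r S, snd x)" and w = "?w"])
    fix y :: "'v filtered list \<times> 'v list"
    \<comment> \<open>The tail of \<open>fst y\<close> is the chosen ordering of \<open>S\<close>
      and so determines \<open>S\<close>; then \<open>fst x\<close> is one of the finitely many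
      orderings of the cone list.\<close>
    have "x \<in> {t. mset t = mset (\<rho> A # Q # map \<rho> (tl (fst y)))} \<times> {snd y} \<and> S = set (tl (fst y))"
      if "(A # ?r S, snd x) = y" "?w x S \<noteq> 0" for x S
    proof -
      have S: "finite S" and o: "orient (\<rho> A # Q # map \<rho> (?r S)) (fst x) \<noteq> (0 :: 'k)"
        using that(2) by (auto split: if_splits)
      have "?r S = tl (fst y)" "snd x = snd y"
        using that(1) by auto
      with orient_permuted[OF o] some_ordering[OF S] show ?thesis
        by (cases x) auto
    qed
    then have "{(x, S). (A # ?r S, snd x) = y \<and> ?w x S \<noteq> 0} \<subseteq>
        ({t. mset t = mset (\<rho> A # Q # map \<rho> (tl (fst y)))} \<times> {snd y}) \<times> {set (tl (fst y))}"
      by blast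
    then show "finite {(x, S). (A # ?r S, snd x) = y \<and> ?w x S \<noteq> 0}"
      by (rule finite_subset) (intro finite_cartesian_product mset_eq_finite; simp)
  qed
  also have "(\<lambda>(c :: ('v, 'k) chain) x. Sum_any (\<lambda>S. ?w x S * c (A # ?r S, snd x))) = cone_homotopy A Q \<rho>"
    by (intro ext, clarsimp simp: cone_homotopy_def, intro arg_cong[of _ _ Sum_any] ext, simp)
  finally show ?thesis .
qed

text \<open>The chosen ordering \<open>u\<close> of \<open>set s\<close> differs from
  \<open>s\<close> by a permutation. Its sign occurs twice, in the coefficient of
  \<open>A # u\<close> and in the orientation of the image, and squares to 1. This is why the
  arbitrary choice is harmless.\<close>

lemma cone_homotopy_generator_Cons:
  assumes "distinct (A # s)"
  shows "cone_homotopy A Q \<rho> (generator (A # s) a) = (generator (\<rho> A # Q # map \<rho> s) a :: ('v, 'k::field) chain)"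
proof (rule ext, clarify)
  fix t :: "'v filtered list" and b :: "'v list"
  let ?r = "\<lambda>S. SOME u. distinct u \<and> set u = S"
  define u where "u = ?r (set s)"
  have u: "distinct u" "set u = set s"
    using some_ordering[of "set s"] by (simp_all add: u_def)
  then have "mset u = mset s"
    using assms by (metis distinct.simps(2) set_eq_iff_mset_eq_distinct)
  then obtain \<pi> where \<pi>: "\<pi> permutes {..<length s}" "u = permute_list \<pi> s"
    by (rule mset_permute_list_obtain)
  have o1: "orient (A # s) (A # u) = (of_int (sign \<pi>) :: 'k)"
    using alternating_Cons[OF alternating_orient[of "A # s"], of A] \<pi> orient_self[OF assms, where ?'k = 'k]
    unfolding alternating_def by (metis mult.right_neutral)
  have "alternating (\<lambda>v. orient t (\<rho> A # Q # v) :: 'k)"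
    by (intro alternating_Cons[of "\<lambda>v. orient t (\<rho> A # v)"] alternating_Cons[of "orient t"] alternating_orient)
  then have "orient t (\<rho> A # Q # permute_list \<pi> (map \<rho> s)) = of_int (sign \<pi>) * (orient t (\<rho> A # Q # map \<rho> s) :: 'k)"
    using \<pi>(1) unfolding alternating_def by simp
  then have o2: "orient (\<rho> A # Q # map \<rho> u) t = of_int (sign \<pi>) * (orient (\<rho> A # Q # map \<rho> s) t :: 'k)"
    unfolding orient_commute[of _ t] \<pi>(2) permute_list_map[OF \<pi>(1)] .
  have "cone_homotopy A Q \<rho> (generator (A # s) a) (t, b) =
    (\<Sum>S\<in>{set s}. if finite S \<and> A \<notin> S
     then orient (\<rho> A # Q # map \<rho> (?r S)) t * generator (A # s) a (A # ?r S, b) else (0::'k))"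
    unfolding cone_homotopy_def prod.case
  proof (rule Sum_any.expand_superset)
    show "{S. (if finite S \<and> A \<notin> S
     then orient (\<rho> A # Q # map \<rho> (?r S)) t * generator (A # s) a (A # ?r S, b) else (0::'k)) \<noteq> 0} \<subseteq> {set s}"
    proof
      fix S assume "S \<in> {S. (if finite S \<and> A \<notin> S
     then orient (\<rho> A # Q # map \<rho> (?r S)) t * generator (A # s) a (A # ?r S, b) else (0::'k)) \<noteq> 0}"
      then have S: "finite S" "orient (A # s) (A # ?r S) \<noteq> (0::'k)"
        by (auto simp: generator_def split: if_splits)
      from orient_permuted[OF S(2)] have "mset (?r S) = mset s" by simp
      from mset_eq_setD[OF this] some_ordering[OF S(1)] show "S \<in> {set s}" by simp
    qed
  qed simp
  also have "\<dots> = of_int (sign \<pi>) * of_int (sign \<pi>) * (orient (\<rho> A # Q # map \<rho> s) t * orient a b)"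
    using assms by (simp add: generator_def u_def[symmetric] o1 o2)
  also have "of_int (sign \<pi>) * of_int (sign \<pi>) = (1 :: 'k)"
    by (simp add: sign_def)
  finally show "cone_homotopy A Q \<rho> (generator (A # s) a) (t, b) = (generator (\<rho> A # Q # map \<rho> s) a (t, b) :: 'k)"
    by (simp add: generator_def)
qed

lemma cone_homotopy_generator_notin:
  assumes "A \<notin> set s"
  shows "cone_homotopy A Q \<rho> (generator s a) = (0 :: ('v, 'k::field) chain)"
proof -
  have "orient s (A # u) = (0 :: 'k)" for u
    using orient_permuted[of s "A # u", where ?'k = 'k] assms by (metis list.set_intros(1) mset_eq_setD)
  then show ?thesis
    by (intro ext) (simp add: cone_homotopy_def generator_def split: prod.split cong: if_cong)
qed

section \<open>Chain maps and a chain homotopy\<close>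

lemma scale_in_tot_chains:
  assumes "c \<in> tot_chains U r"
  shows "(\<lambda>x. k * c x) \<in> tot_chains U r"
proof -
  have "finite {x. k * c x \<noteq> 0}"
    by (rule finite_subset[of _ "{x. c x \<noteq> 0}"]) (use assms in \<open>auto simp: tot_chains_def\<close>)
  then show ?thesis
    using assms unfolding tot_chains_def alternating_def by (auto simp: mult.left_commute)
qed

lemma diff_in_tot_chains: "c \<in> tot_chains U r \<Longrightarrow> d \<in> tot_chains U r \<Longrightarrow> c - d \<in> tot_chains U r"
  unfolding minus_chain_eq by (intro add_in_tot_chains scale_in_tot_chains)

lemma generator_in_tot_chains:
  assumes "set s \<in> nerve U" "set a \<in> inter (set s) r"
  shows "(generator s a :: ('v, 'k::field) chain) \<in> tot_chains U r"
proof (cases "distinct s \<and> distinct a")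
  case True
  have "distinct t \<and> set t \<in> nerve U \<and> distinct b \<and> set b \<in> inter (set t) r"
    if "generator s a (t, b) \<noteq> (0::'k)" for t b
  proof -
    have "mset t = mset s" "mset b = mset a"
      using that orient_permuted[of s t, where ?'k = 'k] orient_permuted[of a b, where ?'k = 'k]
      by (auto simp: generator_def)
    with True assms show ?thesis
      by (metis mset_eq_imp_distinct_iff mset_eq_setD)
  qed
  moreover have "alternating (\<lambda>t. generator s a (t, b) :: 'k)" "alternating (\<lambda>b. generator s a (t, b) :: 'k)" for t b
    using alternating_orient[of s, where ?'k = 'k] alternating_orient[of a, where ?'k = 'k]
    by (auto simp: generator_def alternating_def)
  ultimately show ?thesis
    using fin_supp_generator[of s a, where ?'k = 'k] by (simp add: tot_chains_def fin_supp_def)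
qed (auto simp: generator_not_distinct zero_in_tot_chains)

lemma alternating_mset_eq_zero_iff:
  assumes "alternating f" "mset t = mset s"
  shows "f t = 0 \<longleftrightarrow> f s = (0 :: 'k::field)"
proof -
  obtain \<pi> where "\<pi> permutes {..<length s}" "t = permute_list \<pi> s"
    using assms(2) by (rule mset_permute_list_obtain)
  with assms(1) have "f t = of_int (sign \<pi>) * f s"
    by (simp add: alternating_def)
  then show ?thesis by (simp add: sign_def)
qed

text \<open>Subtracting the multiple of a generator that kills one value strictly shrinks the support.\<close>

lemma tot_chains_induct [consumes 1, case_names zero add generator]:
  fixes c :: "('v, 'k::field) chain"
  assumes "c \<in> tot_chains U r"
    and zero: "P 0"
    and add: "\<And>c d. c \<in> tot_chains U r \<Longrightarrow> d \<in> tot_chains U r \<Longrightarrow> P c \<Longrightarrow> P d \<Longrightarrow> P (c + d)"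
    and generator: "\<And>k s a. distinct s \<Longrightarrow> set s \<in> nerve U \<Longrightarrow> distinct a \<Longrightarrow> set a \<in> inter (set s) r \<Longrightarrow>
      P (\<lambda>x. k * generator s a x)"
  shows "P c"
  using assms(1)
proof (induction "card {x. c x \<noteq> 0}" arbitrary: c rule: less_induct)
  case less
  show ?case
  proof (cases "c = 0")
    case True
    then show ?thesis using zero by simp
  next
    case False
    then obtain s a where sa: "c (s, a) \<noteq> 0" by (auto simp: fun_eq_iff)
    have c: "distinct s" "set s \<in> nerve U" "distinct a" "set a \<in> inter (set s) r"
      "finite {x. c x \<noteq> 0}" "\<And>b. alternating (\<lambda>t. c (t, b))" "\<And>t. alternating (\<lambda>b. c (t, b))"
      using less.prems sa unfolding tot_chains_def by blast+
    define g where "g = (\<lambda>x. c (s, a) * generator s a x)"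
    have g: "g \<in> tot_chains U r"
      unfolding g_def using c by (intro scale_in_tot_chains generator_in_tot_chains)
    have "c x \<noteq> 0" if "g x \<noteq> 0" for x
    proof -
      obtain t b where x: "x = (t, b)" by (cases x)
      have "mset t = mset s" "mset b = mset a"
        using that orient_permuted[of s t, where ?'k = 'k] orient_permuted[of a b, where ?'k = 'k]
        by (auto simp: g_def generator_def x)
      with alternating_mset_eq_zero_iff[OF c(6), of t s b] alternating_mset_eq_zero_iff[OF c(7), of b a s] sa
      show ?thesis by (simp add: x)
    qed
    then have "{x. (c - g) x \<noteq> 0} \<subseteq> {x. c x \<noteq> 0}" by auto
    moreover have "(c - g) (s, a) = 0"
      using c by (simp add: g_def generator_def orient_self)
    ultimately have "{x. (c - g) x \<noteq> 0} \<subset> {x. c x \<noteq> 0}"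
      using sa by blast
    then have "P (c - g)"
      using less.prems g c(5) by (intro less.hyps psubset_card_mono diff_in_tot_chains)
    moreover have "P g"
      unfolding g_def using c by (intro generator)
    ultimately have "P ((c - g) + g)"
      using less.prems g by (intro add diff_in_tot_chains)
    then show ?thesis by simp
  qed
qed

lemma linear_op_eqI:
  fixes c :: "('v, 'k::field) chain"
  assumes "c \<in> tot_chains U r" "linear_op L" "linear_op M"
    and "\<And>s a. distinct s \<Longrightarrow> set s \<in> nerve U \<Longrightarrow> distinct a \<Longrightarrow> set a \<in> inter (set s) r \<Longrightarrow>
      L (generator s a) = M (generator s a)"
  shows "L c = M c"
  using assms(1)
proof (induction rule: tot_chains_induct)
  case zero
  then show ?case by (simp only: linear_op_zero[OF assms(2)] linear_op_zero[OF assms(3)])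
next
  case (add c d)
  then show ?case
    by (simp only: linear_op_add[OF assms(2)] linear_op_add[OF assms(3)] tot_chains_fin_supp[of _ U r])
next
  case (generator k s a)
  then show ?case
    by (simp only: linear_op_scale[OF assms(2)] linear_op_scale[OF assms(3)] fin_supp_generator assms(4))
qed

lemma linear_op_in_tot_chains:
  fixes c :: "('v, 'k::field) chain"
  assumes "c \<in> tot_chains V r" "linear_op L"
    and "\<And>s a. distinct s \<Longrightarrow> set s \<in> nerve V \<Longrightarrow> distinct a \<Longrightarrow> set a \<in> inter (set s) r \<Longrightarrow>
      L (generator s a) \<in> tot_chains U r"
  shows "L c \<in> tot_chains U r"
  using assms(1)
proof (induction rule: tot_chains_induct)
  case zero
  then show ?case by (simp only: linear_op_zero[OF assms(2)] zero_in_tot_chains)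
next
  case (add c d)
  then show ?case
    by (simp only: linear_op_add[OF assms(2)] tot_chains_fin_supp[of _ V r] add_in_tot_chains)
next
  case (generator k s a)
  then show ?case
    by (simp only: linear_op_scale[OF assms(2)] fin_supp_generator scale_in_tot_chains assms(3))
qed

text \<open>Reordering multiplies a generator by a sign, which both operators carry along. It serves
  to bring a chosen vertex to the front.\<close>

lemma linear_op_generator_mset_eq:
  assumes "linear_op L" "linear_op M" "mset s = mset t"
    and "L (generator t a) = M (generator t a :: ('v, 'k::field) chain)"
  shows "L (generator s a) = M (generator s a)"
proof -
  obtain \<pi> where "\<pi> permutes {..<length t}" "s = permute_list \<pi> t"
    using assms(3) by (rule mset_permute_list_obtain)
  then show ?thesis
    by (simp only: generator_permute_list linear_op_scale[OF assms(1)] linear_op_scale[OF assms(2)]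
      fin_supp_generator assms(4))
qed

lemma distinct_omit: "distinct s \<Longrightarrow> distinct (omit i s)"
  by (simp add: set_take_disj_set_drop_if_distinct)

lemma set_omit_subset: "set (omit i s) \<subseteq> set s"
  by (auto dest: in_set_takeD in_set_dropD)

lemma linear_op_cech_diff_generator:
  fixes L :: "('v, 'k::field) chain \<Rightarrow> ('v, 'k) chain"
  assumes "linear_op L" "length s \<ge> 2"
  shows "L (cech_diff (generator s a)) = (\<lambda>x. \<Sum>i<length s. (- 1) ^ i * L (generator (omit i s) a) x)"
  unfolding cech_diff_generator_general[OF assms(2)]
  using linear_op_sum[OF assms(1), of "{..<length s}" "\<lambda>i. generator (omit i s) a" "\<lambda>i. (- 1) ^ i"]
  by (simp add: fin_supp_generator)

text \<open>\<open>vertical_diff\<close> reads its sign off the list at which it is evaluated. All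
  terms vanish at lists whose length differs from that of \<open>s\<close>, so the sign can be fixed
  to that of \<open>s\<close>.\<close>

lemma vertical_diff_generator:
  assumes "distinct a" "length a \<ge> 2"
  shows "vertical_diff (generator s a) =
    (\<lambda>x. \<Sum>i<length a. ((- 1) ^ (length s - 1) * (- 1) ^ i) * generator s (omit i a) x :: 'k::field)"
proof (rule ext, clarify)
  fix t and b :: "'a list"
  have "generator s (omit i a) (t, b) = (0::'k)" if "length t \<noteq> length s" for i
    using that orient_length[of s t, where ?'k = 'k] by (auto simp: generator_def)
  then show "vertical_diff (generator s a) (t, b) =
    (\<Sum>i<length a. ((- 1) ^ (length s - 1) * (- 1) ^ i) * generator s (omit i a) (t, b) :: 'k)"
    unfolding vertical_diff_def simplicial_diff_generator[OF assms]
    by (cases "length t = length s") (simp_all add: sum_distrib_left mult.assoc)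
qed

lemma vertical_diff_generator_short:
  "length a < 2 \<Longrightarrow> vertical_diff (generator s a) = (0 :: ('v, 'k::field) chain)"
  by (simp add: vertical_diff_def simplicial_diff_generator_short fun_eq_iff)

lemma linear_op_vertical_diff_generator:
  fixes L :: "('v, 'k::field) chain \<Rightarrow> ('v, 'k) chain"
  assumes "linear_op L" "distinct a" "length a \<ge> 2"
  shows "L (vertical_diff (generator s a)) =
    (\<lambda>x. \<Sum>i<length a. ((- 1) ^ (length s - 1) * (- 1) ^ i) * L (generator s (omit i a)) x)"
  unfolding vertical_diff_generator[OF assms(2,3)]
  using linear_op_sum[OF assms(1), of "{..<length a}" "\<lambda>i. generator s (omit i a)"
    "\<lambda>i. (- 1) ^ (length s - 1) * (- 1) ^ i"]
  by (simp add: fin_supp_generator)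

text \<open>Omitting an entry commutes with \<open>map \<rho>\<close>, and \<open>map \<rho>\<close>
  keeps the length and with it the column sign. Where \<open>\<rho>\<close> collapses a simplex, the
  cancellation among its faces is contained in \<open>cech_diff_generator_general\<close>.\<close>

theorem push_total_diff:
  fixes c :: "('v, 'k::field) chain"
  assumes "c \<in> tot_chains V r"
  shows "total_diff (push \<rho> c) = push \<rho> (total_diff c)"
proof (rule linear_op_eqI[OF assms])
  show "linear_op (\<lambda>c :: ('v, 'k) chain. total_diff (push \<rho> c))" "linear_op (\<lambda>c :: ('v, 'k) chain. push \<rho> (total_diff c))"
    by (rule linear_op_comp[OF linear_op_total_diff linear_op_push] linear_op_comp[OF linear_op_push linear_op_total_diff])+
next
  fix s :: "'v filtered list" and a :: "'v list"
  assume a: "distinct a"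
  let ?g = "generator s a :: ('v, 'k) chain"
  have "cech_diff (push \<rho> ?g) = push \<rho> (cech_diff ?g)"
  proof (cases "length s \<ge> 2")
    case True
    then have "length (map \<rho> s) \<ge> 2" by simp
    then show ?thesis
      unfolding linear_op_cech_diff_generator[OF linear_op_push True] push_generator_eq
      by (simp add: cech_diff_generator_general take_map drop_map)
  next
    case False
    then show ?thesis
      by (simp add: push_generator_eq cech_diff_generator_short linear_op_zero[OF linear_op_push])
  qed
  moreover have "vertical_diff (push \<rho> ?g) = push \<rho> (vertical_diff ?g)"
  proof (cases "length a \<ge> 2")
    case True
    show ?thesis
      unfolding linear_op_vertical_diff_generator[OF linear_op_push a True] push_generator_eq
      by (simp add: vertical_diff_generator[OF a True])
  next
    case False
    then show ?thesis
      by (simp add: push_generator_eq vertical_diff_generator_short linear_op_zero[OF linear_op_push])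
  qed
  moreover have "fin_supp (cech_diff ?g)" "fin_supp (vertical_diff ?g)"
    by (simp_all add: linear_op_fin_supp linear_op_cech_diff linear_op_vertical_diff fin_supp_generator)
  ultimately show "total_diff (push \<rho> ?g) = push \<rho> (total_diff ?g)"
    by (simp add: total_diff_def linear_op_add[OF linear_op_push])
qed

text \<open>In the Cech boundary of \<open>\<rho> A # Q # map \<rho> s\<close>, dropping the first
  entry gives the push along \<open>\<rho>(A := Q)\<close> and dropping the second gives minus the
  push along \<open>\<rho>\<close>. The other faces cancel against the images of the faces of
  \<open>A # s\<close> that keep \<open>A\<close>, whose positions, and hence signs, are shifted by
  one.\<close>

theorem cone_homotopy_total_diff:
  fixes c :: "('v, 'k::field) chain"
  assumes "c \<in> tot_chains V r"
  shows "total_diff (cone_homotopy A Q \<rho> c) + cone_homotopy A Q \<rho> (total_diff c) = push (\<rho>(A := Q)) c - push \<rho> c"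
proof (rule linear_op_eqI[OF assms])
  let ?h = "cone_homotopy A Q \<rho> :: ('v, 'k) chain \<Rightarrow> ('v, 'k) chain"
  let ?L = "\<lambda>c. total_diff (?h c) + ?h (total_diff c)"
  let ?M = "\<lambda>c :: ('v, 'k) chain. push (\<rho>(A := Q)) c - push \<rho> c"
  show L: "linear_op ?L"
    by (rule linear_op_plus[OF linear_op_comp[OF linear_op_total_diff linear_op_cone_homotopy]
      linear_op_comp[OF linear_op_cone_homotopy linear_op_total_diff]])
  show M: "linear_op ?M"
    by (rule linear_op_minus[OF linear_op_push linear_op_push])
  have h0: "?h 0 = 0"
    by (rule linear_op_zero[OF linear_op_cone_homotopy])
  have split: "?L (generator s a) = cech_diff (?h (generator s a)) + ?h (cech_diff (generator s a)) +
      (vertical_diff (?h (generator s a)) + ?h (vertical_diff (generator s a)))" for s a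
  proof -
    have "fin_supp (cech_diff (generator s a) :: ('v, 'k) chain)" "fin_supp (vertical_diff (generator s a) :: ('v, 'k) chain)"
      by (simp_all add: linear_op_fin_supp linear_op_cech_diff linear_op_vertical_diff fin_supp_generator)
    then show ?thesis
      by (simp add: total_diff_def linear_op_add[OF linear_op_cone_homotopy])
  qed
  \<comment> \<open>Without \<open>A\<close> the two vertex maps agree on \<open>s\<close>, and the
    homotopy vanishes on \<open>s\<close> and on its faces, so both sides are zero.\<close>
  have notin: "?L (generator s a) = ?M (generator s a)" if "A \<notin> set s" "distinct a" for s a
  proof -
    have om: "A \<notin> set (omit i s)" for i
      using that(1) set_omit_subset by fastforce
    have "?h (cech_diff (generator s a)) = 0"
    proof (cases "length s \<ge> 2")
      case True
      show ?thesis
        unfolding linear_op_cech_diff_generator[OF linear_op_cone_homotopy True] cone_homotopy_generator_notin[OF om]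
        by (simp add: fun_eq_iff)
    qed (simp add: cech_diff_generator_short h0)
    moreover have "?h (vertical_diff (generator s a)) = 0"
    proof (cases "length a \<ge> 2")
      case True
      show ?thesis
        unfolding linear_op_vertical_diff_generator[OF linear_op_cone_homotopy that(2) True]
          cone_homotopy_generator_notin[OF that(1)] by (simp add: fun_eq_iff)
    qed (simp add: vertical_diff_generator_short h0)
    moreover have "map (\<rho>(A := Q)) s = map \<rho> s"
      using that(1) by (intro map_cong) auto
    ultimately show ?thesis
      unfolding split push_generator_eq
      by (simp only: cone_homotopy_generator_notin[OF that(1)] linear_op_zero[OF linear_op_cech_diff]
        linear_op_zero[OF linear_op_vertical_diff]) simp
  qed
  have head: "?L (generator (A # s) a) = ?M (generator (A # s) a)" if "distinct (A # s)" "distinct a" for s a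
  proof -
    let ?P = "\<rho> A" and ?n = "length s"
    have om: "distinct (A # omit i s)" for i
      using that(1) distinct_omit[of s i] set_omit_subset[of i s] by auto
    have "cech_diff (?h (generator (A # s) a)) = (\<lambda>x. generator (Q # map \<rho> s) a x - generator (?P # map \<rho> s) a x
        + (\<Sum>i<?n. (- 1) ^ i * generator (?P # Q # map \<rho> (omit i s)) a x))"
      unfolding cone_homotopy_generator_Cons[OF that(1)]
      by (subst cech_diff_generator_general)
        (simp_all add: fun_eq_iff sum.lessThan_Suc_shift take_map drop_map del: sum.lessThan_Suc)
    moreover have "?h (cech_diff (generator (A # s) a))
        = (\<lambda>x. - (\<Sum>i<?n. (- 1) ^ i * generator (?P # Q # map \<rho> (omit i s)) a x))"
    \<comment> \<open>The expansion into faces requires two vertices; for the single vertex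
      \<open>A\<close> both sides are zero.\<close>
    proof (cases "s = []")
      case False
      then have "length (A # s) \<ge> 2" by (cases s) auto
      moreover have "A \<notin> set s" using that(1) by simp
      ultimately show ?thesis
        by (subst linear_op_cech_diff_generator[OF linear_op_cone_homotopy])
          (simp_all add: fun_eq_iff sum.lessThan_Suc_shift cone_homotopy_generator_notin
            cone_homotopy_generator_Cons[OF om] sum_negf del: sum.lessThan_Suc map_append)
    next
      case True
      then show ?thesis by (simp add: cech_diff_generator_short h0 fun_eq_iff)
    qed
    \<comment> \<open>The column sign is \<open>(- 1) ^ (length s + 1)\<close> on the cone and
      \<open>(- 1) ^ length s\<close> on \<open>A # s\<close>.\<close>
    moreover have "vertical_diff (?h (generator (A # s) a)) + ?h (vertical_diff (generator (A # s) a)) = 0"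
    proof (cases "length a \<ge> 2")
      case True
      show ?thesis
        unfolding linear_op_vertical_diff_generator[OF linear_op_cone_homotopy that(2) True] cone_homotopy_generator_Cons[OF that(1)]
        unfolding vertical_diff_generator[OF that(2) True]
        by (simp add: fun_eq_iff sum_negf)
    qed (simp add: cone_homotopy_generator_Cons[OF that(1)] vertical_diff_generator_short h0)
    moreover have upd: "map (\<rho>(A := Q)) (A # s) = Q # map \<rho> s"
      using that(1) by auto
    ultimately show ?thesis
      unfolding split push_generator_eq upd by (simp add: fun_eq_iff)
  qed
  fix s :: "'v filtered list" and a :: "'v list"
  assume s: "distinct s" and a: "distinct a"
  show "?L (generator s a) = ?M (generator s a)"
  proof (cases "A \<in> set s")
    case True
    have "distinct (A # remove1 A s)"
      using s by simp
    from head[OF this a] show ?thesis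
      using True by (intro linear_op_generator_mset_eq[OF L M, of s "A # remove1 A s"]) simp_all
  qed (rule notin[OF _ a])
qed

section \<open>The total differential and refinement maps\<close>

text \<open>The iterated sum becomes a finite sum over a square, where each new index adds a row and
  a column that cancel. The diagonal has its own hypothesis because \<open>f x x = - f x x\<close>
  says nothing in characteristic 2.\<close>

lemma Sum_any_antisymmetric:
  fixes f :: "'i \<Rightarrow> 'i \<Rightarrow> 'k::ab_group_add"
  assumes "finite {(x, y). f x y \<noteq> 0}" "\<And>x. f x x = 0" "\<And>x y. f y x = - f x y"
  shows "Sum_any (\<lambda>x. Sum_any (f x)) = 0"
proof -
  define W where "W = fst ` {(x, y). f x y \<noteq> 0} \<union> snd ` {(x, y). f x y \<noteq> 0}"
  have W: "finite W"
    unfolding W_def using assms(1) by simp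
  have mem: "x \<in> W \<and> y \<in> W" if "f x y \<noteq> 0" for x y
    using that by (force simp: W_def)
  have inner: "Sum_any (f x) = (\<Sum>y\<in>W. f x y)" for x
    using mem by (intro Sum_any.expand_superset W) auto
  have zero: "(\<Sum>x\<in>V. \<Sum>y\<in>V. f x y) = 0" if "finite V" for V
    using that
  proof (induction V rule: finite_induct)
    case (insert z V)
    have "(\<Sum>y\<in>V. f y z) = - (\<Sum>y\<in>V. f z y)"
      unfolding sum_negf[symmetric] by (intro sum.cong refl assms(3))
    with insert show ?case
      by (simp add: sum.distrib assms(2))
  qed simp
  have "Sum_any (\<lambda>x. Sum_any (f x)) = (\<Sum>x\<in>W. \<Sum>y\<in>W. f x y)"
    unfolding inner
  proof (rule Sum_any.expand_superset[OF W])
    show "{x. (\<Sum>y\<in>W. f x y) \<noteq> 0} \<subseteq> W"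
    proof (rule subsetI, rule ccontr)
      fix x assume "x \<in> {x. (\<Sum>y\<in>W. f x y) \<noteq> 0}" "x \<notin> W"
      then have "\<exists>y\<in>W. f x y \<noteq> 0"
        using sum.neutral by (metis (mono_tags, lifting) mem_Collect_eq)
      with mem \<open>x \<notin> W\<close> show False by blast
    qed
  qed
  with zero[OF W] show ?thesis by simp
qed

text \<open>The vanishing on repeated entries comes from the distinctness built into the support, so
  it also holds in characteristic 2.\<close>

lemma tot_chains_swap:
  assumes "c \<in> tot_chains U r"
  shows "c (Y # Z # t, a) = - c (Z # Y # t, a)" "c (Z # Z # t, a) = 0"
    "c (s, v # w # b) = - c (s, w # v # b)" "c (s, v # v # b) = 0"
proof -
  have alt: "alternating (\<lambda>t. c (t, a))" "alternating (\<lambda>b. c (s, b))"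
    and dist: "\<And>s a. c (s, a) \<noteq> 0 \<Longrightarrow> distinct s \<and> distinct a"
    using assms unfolding tot_chains_def by blast+
  have "c (Y # Z # t, a) = (- 1) ^ length [Z] * c (Z # Y # t, a)"
    using alternating_move[OF alt(1), of Y "[Z]" t] unfolding append_Cons append_Nil .
  also have "\<dots> = - c (Z # Y # t, a)" by simp
  finally show "c (Y # Z # t, a) = - c (Z # Y # t, a)" .
  have "c (s, v # w # b) = (- 1) ^ length [w] * c (s, w # v # b)"
    using alternating_move[OF alt(2), of v "[w]" b] unfolding append_Cons append_Nil .
  also have "\<dots> = - c (s, w # v # b)" by simp
  finally show "c (s, v # w # b) = - c (s, w # v # b)" .
  show "c (Z # Z # t, a) = 0" "c (s, v # v # b) = 0"
    using dist[of "Z # Z # t" a] dist[of s "v # v # b"] by auto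
qed

lemma finite_image_preimage:
  assumes "finite {x. c x \<noteq> 0}" "inj g"
  shows "finite {y. c (g y) \<noteq> 0}"
  using finite_vimageI[OF assms] by (simp add: vimage_def)

lemma cech_diff_cech_diff:
  assumes "c \<in> tot_chains U r"
  shows "cech_diff (cech_diff c) = 0"
proof (rule ext, clarify)
  fix t a
  have "finite {y. c ((\<lambda>(Y, Z). (Z # Y # t, a)) y) \<noteq> 0}"
    using tot_chains_fin_supp[OF assms] unfolding fin_supp_def
    by (rule finite_image_preimage) (simp add: inj_on_def)
  then have "finite {(Y, Z). c (Z # Y # t, a) \<noteq> 0}"
    by (simp add: case_prod_unfold)
  then have "Sum_any (\<lambda>Y. Sum_any (\<lambda>Z. c (Z # Y # t, a))) = 0"
    by (rule Sum_any_antisymmetric) (rule tot_chains_swap(1,2)[OF assms])+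
  then show "cech_diff (cech_diff c) (t, a) = 0 (t, a)"
    by (simp add: cech_diff_def)
qed

lemma simplicial_diff_simplicial_diff:
  assumes "c \<in> tot_chains U r"
  shows "simplicial_diff (simplicial_diff c) = 0"
proof (rule ext, clarify)
  fix s b
  have "finite {y. c ((\<lambda>(v, w). (s, w # v # b)) y) \<noteq> 0}"
    using tot_chains_fin_supp[OF assms] unfolding fin_supp_def
    by (rule finite_image_preimage) (simp add: inj_on_def)
  then have "finite {(v, w). c (s, w # v # b) \<noteq> 0}"
    by (simp add: case_prod_unfold)
  then have "Sum_any (\<lambda>v. Sum_any (\<lambda>w. c (s, w # v # b))) = 0"
    by (rule Sum_any_antisymmetric) (rule tot_chains_swap(3,4)[OF assms])+
  then show "simplicial_diff (simplicial_diff c) (s, b) = 0 (s, b)"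
    by (simp add: simplicial_diff_def)
qed

lemma cech_diff_simplicial_diff:
  assumes "fin_supp c"
  shows "cech_diff (simplicial_diff c) = simplicial_diff (cech_diff c)"
proof (rule ext, clarify)
  fix t b
  let ?F = "{y. c ((\<lambda>(Y, v). (Y # t, v # b)) y) \<noteq> 0}"
  have "finite ?F"
    using assms unfolding fin_supp_def by (rule finite_image_preimage) (simp add: inj_on_def)
  \<comment> \<open>Exchanging the sums requires a finite rectangle around the support; the two
    projections provide it.\<close>
  then have "finite (fst ` ?F \<times> snd ` ?F)" by simp
  then have "Sum_any (\<lambda>Y. Sum_any (\<lambda>v. c (Y # t, v # b))) = Sum_any (\<lambda>v. Sum_any (\<lambda>Y. c (Y # t, v # b)))"
    by (rule Sum_any.swap) (force simp: image_iff)
  then show "cech_diff (simplicial_diff c) (t, b) = simplicial_diff (cech_diff c) (t, b)"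
    by (simp add: cech_diff_def simplicial_diff_def)
qed

text \<open>In the vertical square both column signs belong to the same \<open>s\<close> and factor
  out. In the mixed terms \<open>cech_diff\<close> at \<open>t\<close> reads lists
  \<open>Y # t\<close>, whose column sign is opposite to that of \<open>t\<close>.\<close>

theorem total_diff_total_diff:
  assumes "c \<in> tot_chains U r"
  shows "total_diff (total_diff c) = 0"
proof -
  have fin: "fin_supp c" "fin_supp (cech_diff c)" "fin_supp (vertical_diff c)"
    using tot_chains_fin_supp[OF assms]
    by (simp_all add: linear_op_fin_supp linear_op_cech_diff linear_op_vertical_diff)
  have "vertical_diff (vertical_diff c) = 0"
  proof (rule ext, clarify)
    fix s b
    have vert: "vertical_diff c (t, b) = (- 1) ^ (length t - 1) * simplicial_diff c (t, b)" for t b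
      by (simp add: vertical_diff_def)
    have "simplicial_diff (vertical_diff c) (s, b) = (- 1) ^ (length s - 1) * simplicial_diff (simplicial_diff c) (s, b)"
    proof -
      have "finite {v. simplicial_diff c (s, v # b) \<noteq> 0}"
        using linear_op_fin_supp[OF linear_op_simplicial_diff fin(1)] finite_image_preimage[of "simplicial_diff c" "\<lambda>v. (s, v # b)"]
        by (simp add: fin_supp_def inj_on_def)
      from Sum_any_right_distrib[OF this, of "(- 1) ^ (length s - 1)"] show ?thesis
        by (simp add: simplicial_diff_def[of "vertical_diff c"] simplicial_diff_def[of "simplicial_diff c"] vert)
    qed
    then show "vertical_diff (vertical_diff c) (s, b) = 0 (s, b)"
      by (simp add: vertical_diff_def[of "vertical_diff c"] simplicial_diff_simplicial_diff[OF assms])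
  qed
  moreover have "cech_diff (vertical_diff c) + vertical_diff (cech_diff c) = 0"
  proof (rule ext, clarify)
    fix t b
    show "(cech_diff (vertical_diff c) + vertical_diff (cech_diff c)) (t, b) = 0 (t, b)"
    proof (cases "t = []")
      case False
      have "finite {Y. simplicial_diff c (Y # t, b) \<noteq> 0}"
        using linear_op_fin_supp[OF linear_op_simplicial_diff fin(1)] finite_image_preimage[of "simplicial_diff c" "\<lambda>Y. (Y # t, b)"]
        by (simp add: fin_supp_def inj_on_def)
      from Sum_any_right_distrib[OF this, of "(- 1) ^ length t"] False
      have "cech_diff (vertical_diff c) (t, b) = (- 1) ^ length t * cech_diff (simplicial_diff c) (t, b)"
        by (simp add: cech_diff_def vertical_diff_def)
      \<comment> \<open>This fails for \<open>t = []\<close>, where natural subtraction makes the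
        exponents equal; that case is settled by both terms being zero.\<close>
      moreover have "(- 1) ^ length t = - ((- 1) ^ (length t - 1) :: 'b)"
        using False by (cases t) simp_all
      ultimately show ?thesis
        by (simp add: vertical_diff_def[of "cech_diff c"] cech_diff_simplicial_diff[OF fin(1)])
    qed (simp add: cech_diff_def vertical_diff_def simplicial_diff_def)
  qed
  ultimately show ?thesis
    using cech_diff_cech_diff[OF assms]
    by (simp add: total_diff_def linear_op_add[OF linear_op_cech_diff fin(2,3)]
      linear_op_add[OF linear_op_vertical_diff fin(2,3)] add.assoc add.left_commute)
qed

section \<open>Chains under refinement maps and under the homotopy\<close>

text \<open>Fewer members have a larger intersection, so the claim passes to every nonempty part of
  the union. In this form it serves both the cone lists and the vertex maps that mix
  \<open>\<rho>\<close> and \<open>\<tau>\<close>.\<close>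

lemma refinement_map_contiguous:
  assumes "refinement_map V U \<rho>" "refinement_map V U \<tau>" "\<sigma> \<in> nerve V"
    and "\<kappa> \<subseteq> \<rho> ` \<sigma> \<union> \<tau> ` \<sigma>" "\<kappa> \<noteq> {}"
  shows "\<kappa> \<in> nerve U" "inter \<sigma> r \<subseteq> inter \<kappa> r"
proof -
  have \<rho>: "\<rho> ` \<sigma> \<in> nerve U" "inter \<sigma> r \<subseteq> inter (\<rho> ` \<sigma>) r"
    and \<tau>: "\<tau> ` \<sigma> \<in> nerve U" "inter \<sigma> r \<subseteq> inter (\<tau> ` \<sigma>) r" for r
    using assms(1-3) by (auto simp: refinement_map_def)
  show sub: "inter \<sigma> r \<subseteq> inter \<kappa> r" for r
    using \<rho>(2)[of r] \<tau>(2)[of r] assms(4) by (fastforce simp: inter_def)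
  have fin: "finite \<sigma>" and "\<exists>r. inter \<sigma> r \<noteq> {}"
    using assms(3) by (auto simp: nerve_def)
  then have "\<exists>r. inter \<kappa> r \<noteq> {}"
    using sub by blast
  moreover have "finite \<kappa>"
    by (rule finite_subset[OF assms(4)]) (use fin in simp)
  moreover have "\<kappa> \<subseteq> U"
    using assms(4) \<rho>(1) \<tau>(1) unfolding nerve_def by blast
  ultimately show "\<kappa> \<in> nerve U"
    using assms(5) by (simp add: nerve_def)
qed

lemma push_in_tot_chains:
  fixes c :: "('v, 'k::field) chain"
  assumes "refinement_map V U \<rho>" "c \<in> tot_chains V r"
  shows "push \<rho> c \<in> tot_chains U r"
proof (rule linear_op_in_tot_chains[OF assms(2) linear_op_push])
  fix s :: "'v filtered list" and a :: "'v list"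
  assume "set s \<in> nerve V" "set a \<in> inter (set s) r"
  then show "(push \<rho> (generator s a) :: ('v, 'k) chain) \<in> tot_chains U r"
    using assms(1) unfolding push_generator_eq refinement_map_def by (intro generator_in_tot_chains) auto
qed

lemma cone_homotopy_in_tot_chains:
  fixes c :: "('v, 'k::field) chain"
  assumes "refinement_map V U \<rho>" "refinement_map V U (\<rho>(A := Q))" "c \<in> tot_chains V r"
  shows "cone_homotopy A Q \<rho> c \<in> tot_chains U r"
proof (rule linear_op_in_tot_chains[OF assms(3) linear_op_cone_homotopy])
  fix s :: "'v filtered list" and a :: "'v list"
  assume s: "distinct s" "set s \<in> nerve V" "set a \<in> inter (set s) r"
  have L: "linear_op (cone_homotopy A Q \<rho> :: ('v, 'k) chain \<Rightarrow> _)"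
    by (rule linear_op_cone_homotopy)
  show "(cone_homotopy A Q \<rho> (generator s a) :: ('v, 'k) chain) \<in> tot_chains U r"
  proof (cases "A \<in> set s")
    case True
    define u where "u = remove1 A s"
    have u: "distinct (A # u)" "mset s = mset (A # u)" "set s = insert A (set u)"
      using s(1) True by (auto simp: u_def)
    \<comment> \<open>\<open>Q\<close> is the value of \<open>\<rho>(A := Q)\<close> at
      \<open>A\<close>, so the cone lies in the union of the two images.\<close>
    have sub: "set (\<rho> A # Q # map \<rho> u) \<subseteq> \<rho> ` set s \<union> (\<rho>(A := Q)) ` set s"
      using True by (auto simp: u(3))
    have "(cone_homotopy A Q \<rho> (generator (A # u) a) :: ('v, 'k) chain) \<in> tot_chains U r"
      unfolding cone_homotopy_generator_Cons[OF u(1)]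
    proof (rule generator_in_tot_chains)
      show "set (\<rho> A # Q # map \<rho> u) \<in> nerve U" "set a \<in> inter (set (\<rho> A # Q # map \<rho> u)) r"
        using refinement_map_contiguous(1)[OF assms(1,2) s(2) sub]
          refinement_map_contiguous(2)[OF assms(1,2) s(2) sub, of r] s(3) by auto
    qed
    moreover obtain \<pi> where \<pi>: "\<pi> permutes {..<length (A # u)}" "s = permute_list \<pi> (A # u)"
      using u(2) by (rule mset_permute_list_obtain)
    ultimately show ?thesis
      unfolding \<pi>(2) generator_permute_list[OF \<pi>(1)] linear_op_scale[OF L fin_supp_generator]
      by (intro scale_in_tot_chains)
  qed (simp only: cone_homotopy_generator_notin zero_in_tot_chains not_False_eq_True)
qed

lemma push_support:
  assumes "push \<rho> c x \<noteq> 0"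
  obtains y where "c y \<noteq> 0" "bidegree y = bidegree x"
proof -
  obtain t a where x: "x = (t, a)" by (cases x)
  obtain s where "(if map \<rho> s = t \<and> distinct t then c (s, a) else 0) \<noteq> 0"
    using assms by (auto simp: x push_def elim: Sum_any.not_neutral_obtains_not_neutral)
  then show ?thesis
    by (intro that[of "(s, a)"]) (auto simp: x bidegree_def split: if_splits)
qed

lemma cone_homotopy_support:
  fixes c :: "('v, 'k::field) chain"
  assumes "cone_homotopy A Q \<rho> c x \<noteq> 0"
  obtains y where "c y \<noteq> 0" "bidegree x = (fst (bidegree y) + 1, snd (bidegree y))"
proof -
  obtain t b where x: "x = (t, b)" by (cases x)
  let ?r = "\<lambda>S. SOME u. distinct u \<and> set u = S"
  obtain S where "(if finite S \<and> A \<notin> S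
     then orient (\<rho> A # Q # map \<rho> (?r S)) t * c (A # ?r S, b) else 0) \<noteq> 0"
    using assms unfolding x cone_homotopy_def prod.case by (rule Sum_any.not_neutral_obtains_not_neutral)
  then have "orient (\<rho> A # Q # map \<rho> (?r S)) t \<noteq> (0 :: 'k)" "c (A # ?r S, b) \<noteq> 0"
    by (auto split: if_splits)
  then show ?thesis
    using orient_length[of "\<rho> A # Q # map \<rho> (?r S)" t, where ?'k = 'k]
    by (intro that[of "(A # ?r S, b)"]) (auto simp: x bidegree_def)
qed

lemma push_in_tot_filtration:
  assumes "refinement_map V U \<rho>" "c \<in> tot_filtration V r p m"
  shows "push \<rho> c \<in> tot_filtration U r p m"
proof -
  have c: "c \<in> tot_chains V r" "\<And>x. c x \<noteq> 0 \<Longrightarrow> fst (bidegree x) + snd (bidegree x) = m \<and> fst (bidegree x) \<le> p"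
    using assms(2) by (auto simp: tot_filtration_def)
  have "fst (bidegree x) + snd (bidegree x) = m \<and> fst (bidegree x) \<le> p"
    if nz: "push \<rho> c x \<noteq> 0" for x
  proof -
    obtain y where "c y \<noteq> 0" "bidegree y = bidegree x"
      using nz by (rule push_support)
    with c(2)[of y] show ?thesis by simp
  qed
  with push_in_tot_chains[OF assms(1) c(1)] show ?thesis
    by (simp add: tot_filtration_def)
qed

lemma cone_homotopy_in_tot_filtration:
  assumes "refinement_map V U \<rho>" "refinement_map V U (\<rho>(A := Q))" "c \<in> tot_filtration V r p m"
  shows "cone_homotopy A Q \<rho> c \<in> tot_filtration U r (p + 1) (m + 1)"
proof -
  have c: "c \<in> tot_chains V r" "\<And>x. c x \<noteq> 0 \<Longrightarrow> fst (bidegree x) + snd (bidegree x) = m \<and> fst (bidegree x) \<le> p"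
    using assms(3) by (auto simp: tot_filtration_def)
  have "fst (bidegree x) + snd (bidegree x) = m + 1 \<and> fst (bidegree x) \<le> p + 1"
    if nz: "cone_homotopy A Q \<rho> c x \<noteq> 0" for x
  proof -
    obtain y where "c y \<noteq> 0" "bidegree x = (fst (bidegree y) + 1, snd (bidegree y))"
      using nz by (rule cone_homotopy_support)
    with c(2)[of y] show ?thesis by simp
  qed
  with cone_homotopy_in_tot_chains[OF assms(1,2) c(1)] show ?thesis
    by (simp add: tot_filtration_def)
qed

section \<open>Cycles, boundaries and classes\<close>

lemma tot_filtration_tot_chains: "c \<in> tot_filtration U r p m \<Longrightarrow> c \<in> tot_chains U r"
  by (simp add: tot_filtration_def)

lemma tot_filtration_fin_supp: "c \<in> tot_filtration U r p m \<Longrightarrow> fin_supp c"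
  by (rule tot_chains_fin_supp[OF tot_filtration_tot_chains])

lemma tot_filtration_mono: "c \<in> tot_filtration U r p m \<Longrightarrow> p \<le> p' \<Longrightarrow> c \<in> tot_filtration U r p' m"
  unfolding tot_filtration_def by (force intro: order_trans)

lemma zero_in_tot_filtration: "0 \<in> tot_filtration U r p m"
  by (simp add: tot_filtration_def zero_in_tot_chains)

lemma add_in_tot_filtration:
  assumes "c \<in> tot_filtration U r p m" "d \<in> tot_filtration U r p m"
  shows "c + d \<in> tot_filtration U r p m"
proof -
  have "c x \<noteq> 0 \<or> d x \<noteq> 0" if "(c + d) x \<noteq> 0" for x
    using that by auto
  then show ?thesis
    using assms add_in_tot_chains[of c U r d] unfolding tot_filtration_def by blast
qed

lemma scale_in_tot_filtration:
  assumes "c \<in> tot_filtration U r p m"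
  shows "(\<lambda>x. k * c x) \<in> tot_filtration U r p m"
  using assms scale_in_tot_chains[of c U r k] unfolding tot_filtration_def by auto

lemma diff_in_tot_filtration:
  "c \<in> tot_filtration U r p m \<Longrightarrow> d \<in> tot_filtration U r p m \<Longrightarrow> c - d \<in> tot_filtration U r p m"
  unfolding minus_chain_eq by (intro add_in_tot_filtration scale_in_tot_filtration)

lemma ss_cycles_fin_supp: "c \<in> ss_cycles U r n p q \<Longrightarrow> fin_supp c"
  unfolding ss_cycles_def by (auto dest: tot_filtration_fin_supp)

lemma ss_cycles_tot_chains: "c \<in> ss_cycles U r n p q \<Longrightarrow> c \<in> tot_chains U r"
  unfolding ss_cycles_def by (auto dest: tot_filtration_tot_chains)

lemma zero_in_ss_cycles: "0 \<in> ss_cycles U r n p q"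
  by (simp add: ss_cycles_def zero_in_tot_filtration linear_op_zero[OF linear_op_total_diff])

lemma add_in_ss_cycles:
  assumes "c \<in> ss_cycles U r n p q" "d \<in> ss_cycles U r n p q"
  shows "c + d \<in> ss_cycles U r n p q"
  using assms linear_op_add[OF linear_op_total_diff, of c d] ss_cycles_fin_supp[OF assms(1)] ss_cycles_fin_supp[OF assms(2)]
  unfolding ss_cycles_def by (simp only: mem_Collect_eq add_in_tot_filtration simp_thms)

lemma scale_in_ss_cycles:
  assumes "c \<in> ss_cycles U r n p q"
  shows "(\<lambda>x. k * c x) \<in> ss_cycles U r n p q"
  using assms linear_op_scale[OF linear_op_total_diff, of c k] ss_cycles_fin_supp[OF assms(1)]
  unfolding ss_cycles_def by (simp only: mem_Collect_eq scale_in_tot_filtration simp_thms)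

lemma diff_in_ss_cycles:
  "c \<in> ss_cycles U r n p q \<Longrightarrow> d \<in> ss_cycles U r n p q \<Longrightarrow> c - d \<in> ss_cycles U r n p q"
  unfolding minus_chain_eq by (intro add_in_ss_cycles scale_in_ss_cycles)

text \<open>The page \<open>m\<close> is arbitrary: the differential of \<open>total_diff c\<close>
  is zero and lies in every filtration step.\<close>

lemma total_diff_in_ss_cycles:
  assumes "c \<in> ss_cycles U r n p q"
  shows "total_diff c \<in> ss_cycles U r m (p - n) (q + n - 1)"
  using assms total_diff_total_diff[OF ss_cycles_tot_chains[OF assms]]
  unfolding ss_cycles_def by (simp add: zero_in_tot_filtration add_diff_eq)

lemma ss_boundsI:
  "b \<in> ss_cycles U r (n - 1) (p - 1) (q + 1) \<Longrightarrow> c \<in> ss_cycles U r (n - 1) (p + n - 1) (q - n + 2) \<Longrightarrow>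
   x = b + total_diff c \<Longrightarrow> x \<in> ss_bounds U r n p q"
  unfolding ss_bounds_def by blast

lemma ss_boundsE:
  assumes "x \<in> ss_bounds U r n p q"
  obtains b c where "b \<in> ss_cycles U r (n - 1) (p - 1) (q + 1)"
    "c \<in> ss_cycles U r (n - 1) (p + n - 1) (q - n + 2)" "x = b + total_diff c"
  using assms unfolding ss_bounds_def by blast

lemma zero_in_ss_bounds: "0 \<in> ss_bounds U r n p q"
  by (rule ss_boundsI[OF zero_in_ss_cycles zero_in_ss_cycles]) (simp add: linear_op_zero[OF linear_op_total_diff])

lemma add_in_ss_bounds:
  assumes "x \<in> ss_bounds U r n p q" "y \<in> ss_bounds U r n p q"
  shows "x + y \<in> ss_bounds U r n p q"
proof -
  obtain b c where x: "b \<in> ss_cycles U r (n - 1) (p - 1) (q + 1)"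
    "c \<in> ss_cycles U r (n - 1) (p + n - 1) (q - n + 2)" "x = b + total_diff c"
    using assms(1) by (rule ss_boundsE)
  obtain b' c' where y: "b' \<in> ss_cycles U r (n - 1) (p - 1) (q + 1)"
    "c' \<in> ss_cycles U r (n - 1) (p + n - 1) (q - n + 2)" "y = b' + total_diff c'"
    using assms(2) by (rule ss_boundsE)
  show ?thesis
    using linear_op_add[OF linear_op_total_diff ss_cycles_fin_supp[OF x(2)] ss_cycles_fin_supp[OF y(2)]] x(3) y(3)
    by (intro ss_boundsI[OF add_in_ss_cycles[OF x(1) y(1)] add_in_ss_cycles[OF x(2) y(2)]])
      (simp only: ac_simps)
qed

lemma scale_in_ss_bounds:
  assumes "x \<in> ss_bounds U r n p q"
  shows "(\<lambda>y. k * x y) \<in> ss_bounds U r n p q"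
proof -
  obtain b c where x: "b \<in> ss_cycles U r (n - 1) (p - 1) (q + 1)"
    "c \<in> ss_cycles U r (n - 1) (p + n - 1) (q - n + 2)" "x = b + total_diff c"
    using assms(1) by (rule ss_boundsE)
  show ?thesis
    using linear_op_scale[OF linear_op_total_diff ss_cycles_fin_supp[OF x(2)], of k] x(3)
    by (intro ss_boundsI[OF scale_in_ss_cycles[OF x(1), of k] scale_in_ss_cycles[OF x(2), of k]])
      (simp add: fun_eq_iff distrib_left)
qed

lemma diff_in_ss_bounds:
  "x \<in> ss_bounds U r n p q \<Longrightarrow> y \<in> ss_bounds U r n p q \<Longrightarrow> x - y \<in> ss_bounds U r n p q"
  unfolding minus_chain_eq by (intro add_in_ss_bounds scale_in_ss_bounds)

lemma lower_in_ss_bounds: "b \<in> ss_cycles U r (n - 1) (p - 1) (q + 1) \<Longrightarrow> b \<in> ss_bounds U r n p q"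
  by (rule ss_boundsI[OF _ zero_in_ss_cycles]) (simp_all add: linear_op_zero[OF linear_op_total_diff])

text \<open>Page and filtration index both drop by one, so the bound \<open>p - n\<close> on the
  differential stays the same.\<close>

lemma lower_in_ss_cycles:
  "b \<in> ss_cycles U r (n - 1) (p - 1) (q + 1) \<Longrightarrow> b \<in> ss_cycles U r n p q"
  unfolding ss_cycles_def by (auto intro: tot_filtration_mono)

lemma ss_relD:
  assumes "(x, y) \<in> ss_rel U r n p q"
  shows "x \<in> ss_cycles U r (int n) p q" "y \<in> ss_cycles U r (int n) p q" "x - y \<in> ss_bounds U r (int n) p q"
  using assms by (simp_all add: ss_rel_def)

lemma equiv_ss_rel: "equiv (ss_cycles U r (int n) p q) (ss_rel U r n p q)"
proof (rule equivI)
  show "refl_on (ss_cycles U r (int n) p q) (ss_rel U r n p q)"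
    by (simp add: refl_on_def ss_rel_def zero_in_ss_bounds)
  show "sym (ss_rel U r n p q)"
  proof (rule symI)
    fix x y assume xy: "(x, y) \<in> ss_rel U r n p q"
    have "y - x \<in> ss_bounds U r (int n) p q"
      using diff_in_ss_bounds[OF zero_in_ss_bounds ss_relD(3)[OF xy]] by simp
    with ss_relD(1,2)[OF xy] show "(y, x) \<in> ss_rel U r n p q"
      by (simp add: ss_rel_def)
  qed
  show "trans (ss_rel U r n p q)"
  proof (rule transI)
    fix x y z assume xy: "(x, y) \<in> ss_rel U r n p q" and yz: "(y, z) \<in> ss_rel U r n p q"
    have "x - z \<in> ss_bounds U r (int n) p q"
      using add_in_ss_bounds[OF ss_relD(3)[OF xy] ss_relD(3)[OF yz]] by simp
    with ss_relD(1)[OF xy] ss_relD(2)[OF yz] show "(x, z) \<in> ss_rel U r n p q"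
      by (simp add: ss_rel_def)
  qed
  show "ss_rel U r n p q \<subseteq> ss_cycles U r (int n) p q \<times> ss_cycles U r (int n) p q"
    by (rule subrelI) (simp add: ss_relD)
qed

text \<open>The operations on pages are images of whole sets of representatives. This reduces their
  evaluation, and with it their being well defined, to comparing all members with a single
  one.\<close>

lemma ss_rel_Image_eq:
  assumes "x \<in> S" "\<And>y. y \<in> S \<Longrightarrow> (x, y) \<in> ss_rel U r n p q"
  shows "ss_rel U r n p q `` S = ss_rel U r n p q `` {x}"
proof -
  have "ss_rel U r n p q `` S = (\<Union>y\<in>S. ss_rel U r n p q `` {y})"
    by (rule Image_eq_UN)
  also have "\<dots> = (\<Union>y\<in>S. ss_rel U r n p q `` {x})"
    by (rule SUP_cong[OF refl], rule equiv_class_eq[OF equiv_ss_rel, symmetric], rule assms(2))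
  also have "\<dots> = ss_rel U r n p q `` {x}"
    using assms(1) by (simp only: UN_constant) auto
  finally show ?thesis .
qed

lemma ss_rel_class_eq_iff:
  assumes "x \<in> ss_cycles U r (int n) p q" "y \<in> ss_cycles U r (int n) p q"
  shows "ss_rel U r n p q `` {x} = ss_rel U r n p q `` {y} \<longleftrightarrow> x - y \<in> ss_bounds U r (int n) p q"
  using eq_equiv_class_iff[OF equiv_ss_rel assms] assms by (simp add: ss_rel_def)

lemma self_in_class: "x \<in> ss_cycles U r (int n) p q \<Longrightarrow> x \<in> ss_rel U r n p q `` {x}"
  by (rule equiv_class_self[OF equiv_ss_rel])

section \<open>Operations on the pages computed on representatives\<close>

lemma page_cases:
  assumes "A \<in> page (mv_spectral_sequence U) n p q r"
  obtains x where "x \<in> ss_cycles U r (int n) p q" "A = ss_rel U r n p q `` {x}"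
  using assms by (auto simp: mv_spectral_sequence_def elim: quotientE)

lemma class_in_page:
  "x \<in> ss_cycles U r (int n) p q \<Longrightarrow> ss_rel U r n p q `` {x} \<in> page (mv_spectral_sequence U) n p q r"
  by (simp add: mv_spectral_sequence_def quotientI)

lemma add_class_eq:
  assumes "x \<in> ss_cycles U r (int n) p q" "y \<in> ss_cycles U r (int n) p q"
  shows "add_class (mv_spectral_sequence U) n p q r (ss_rel U r n p q `` {x}) (ss_rel U r n p q `` {y})
    = ss_rel U r n p q `` {x + y}"
proof -
  have "(x + y, z) \<in> ss_rel U r n p q"
    if mem: "z \<in> {v + w | v w. v \<in> ss_rel U r n p q `` {x} \<and> w \<in> ss_rel U r n p q `` {y}}" for z
  proof -
    obtain v w where z: "z = v + w" "(x, v) \<in> ss_rel U r n p q" "(y, w) \<in> ss_rel U r n p q"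
      using mem by auto
    have "x + y - z \<in> ss_bounds U r (int n) p q"
      unfolding z(1) add_diff_add by (rule add_in_ss_bounds[OF ss_relD(3)[OF z(2)] ss_relD(3)[OF z(3)]])
    moreover have "z \<in> ss_cycles U r (int n) p q"
      unfolding z(1) by (rule add_in_ss_cycles[OF ss_relD(2)[OF z(2)] ss_relD(2)[OF z(3)]])
    ultimately show ?thesis
      using add_in_ss_cycles[OF assms]
      by (simp add: ss_rel_def)
  qed
  moreover have "x + y \<in> {v + w | v w. v \<in> ss_rel U r n p q `` {x} \<and> w \<in> ss_rel U r n p q `` {y}}"
    using self_in_class[OF assms(1)] self_in_class[OF assms(2)] by blast
  ultimately show ?thesis
    unfolding mv_spectral_sequence_def spectral_sequence.simps by (intro ss_rel_Image_eq)
qed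

lemma scale_class_eq:
  assumes "x \<in> ss_cycles U r (int n) p q"
  shows "scale_class (mv_spectral_sequence U) n p q r k (ss_rel U r n p q `` {x})
    = ss_rel U r n p q `` {\<lambda>y. k * x y}"
proof -
  have "((\<lambda>y. k * x y), z) \<in> ss_rel U r n p q"
    if mem: "z \<in> (\<lambda>c y. k * c y) ` (ss_rel U r n p q `` {x})" for z
  proof -
    obtain v where z: "z = (\<lambda>y. k * v y)" "(x, v) \<in> ss_rel U r n p q"
      using mem by auto
    have "(\<lambda>y. k * x y) - z = (\<lambda>y. k * (x - v) y)"
      by (simp add: z(1) fun_eq_iff right_diff_distrib)
    moreover have "z \<in> ss_cycles U r (int n) p q"
      unfolding z(1) by (rule scale_in_ss_cycles[OF ss_relD(2)[OF z(2)]])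
    ultimately show ?thesis
      using scale_in_ss_bounds[OF ss_relD(3)[OF z(2)], of k] scale_in_ss_cycles[OF assms, of k]
      by (simp add: ss_rel_def)
  qed
  moreover have "(\<lambda>y. k * x y) \<in> (\<lambda>c y. k * c y) ` (ss_rel U r n p q `` {x})"
    using self_in_class[OF assms(1)] by blast
  ultimately show ?thesis
    unfolding mv_spectral_sequence_def spectral_sequence.simps by (intro ss_rel_Image_eq)
qed

text \<open>If two representatives differ by \<open>b + total_diff c\<close>, their differentials
  differ by \<open>total_diff b\<close>. At the target bidegree the index of the second kind of
  boundary is again \<open>(p - 1, q + 1)\<close>, the position of \<open>b\<close>.\<close>

lemma page_diff_class_eq:
  assumes "x \<in> ss_cycles U r (int n) p q"
  shows "page_diff (mv_spectral_sequence U) n p q r (ss_rel U r n p q `` {x})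
    = ss_rel U r n (p - int n) (q + int n - 1) `` {total_diff x}"
proof -
  have "(total_diff x, z) \<in> ss_rel U r n (p - int n) (q + int n - 1)"
    if mem: "z \<in> total_diff ` (ss_rel U r n p q `` {x})" for z
  proof -
    obtain v where z: "z = total_diff v" "(x, v) \<in> ss_rel U r n p q"
      using mem by auto
    note v = ss_relD[OF z(2)]
    obtain b c where b: "b \<in> ss_cycles U r (int n - 1) (p - 1) (q + 1)"
      and c: "c \<in> ss_cycles U r (int n - 1) (p + int n - 1) (q - int n + 2)" and xv: "x - v = b + total_diff c"
      using v(3) by (rule ss_boundsE)
    have "total_diff x - z = total_diff (x - v)"
      using linear_op_diff[OF linear_op_total_diff ss_cycles_fin_supp[OF v(1)] ss_cycles_fin_supp[OF v(2)]]
      by (simp only: z(1))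
    also have "\<dots> = total_diff b"
      unfolding xv linear_op_add[OF linear_op_total_diff ss_cycles_fin_supp[OF b]
          linear_op_fin_supp[OF linear_op_total_diff ss_cycles_fin_supp[OF c]]]
        total_diff_total_diff[OF ss_cycles_tot_chains[OF c]] by simp
    also have "\<dots> \<in> ss_bounds U r (int n) (p - int n) (q + int n - 1)"
      using b by (intro ss_boundsI[OF zero_in_ss_cycles, of b]) (simp_all add: algebra_simps)
    finally show ?thesis
      using total_diff_in_ss_cycles[OF v(1), of "int n"] total_diff_in_ss_cycles[OF v(2), of "int n"]
      by (simp add: ss_rel_def z(1))
  qed
  moreover have "total_diff x \<in> total_diff ` (ss_rel U r n p q `` {x})"
    using self_in_class[OF assms(1)] by blast
  ultimately show ?thesis
    unfolding mv_spectral_sequence_def spectral_sequence.simps by (intro ss_rel_Image_eq)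
qed

text \<open>The decomposition \<open>b + total_diff c\<close> can be kept. Since \<open>z\<close>
  and \<open>b\<close> have the same differential, \<open>b\<close> inherits the sharper condition
  from \<open>z\<close>, and \<open>c\<close> only moves to a larger filtration step. This makes
  \<open>to_succ\<close> well defined.\<close>

lemma ss_bounds_Suc:
  assumes "z \<in> ss_bounds U r n p q" "z \<in> ss_cycles U r (n + 1) p q"
  shows "z \<in> ss_bounds U r (n + 1) p q"
proof -
  obtain b c where b: "b \<in> ss_cycles U r (n - 1) (p - 1) (q + 1)"
    and c: "c \<in> ss_cycles U r (n - 1) (p + n - 1) (q - n + 2)" and z: "z = b + total_diff c"
    using assms(1) by (rule ss_boundsE)
  have "total_diff z = total_diff b"
    unfolding z linear_op_add[OF linear_op_total_diff ss_cycles_fin_supp[OF b]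
        linear_op_fin_supp[OF linear_op_total_diff ss_cycles_fin_supp[OF c]]]
      total_diff_total_diff[OF ss_cycles_tot_chains[OF c]] by simp
  then have "b \<in> ss_cycles U r n (p - 1) (q + 1)"
    using assms(2) b by (simp add: ss_cycles_def diff_diff_eq add.commute)
  moreover have "c \<in> ss_cycles U r n (p + n) (q - n + 1)"
    using c tot_filtration_mono[of c U r "p + n - 1" "p + q + 1" "p + n"] by (simp add: ss_cycles_def ac_simps)
  ultimately show ?thesis
    by (intro ss_boundsI[of b _ _ _ _ _ c]) (simp_all add: z algebra_simps)
qed

lemma to_succ_class_eq:
  assumes "x \<in> ss_cycles U r (int (Suc n)) p q" "x \<in> ss_cycles U r (int n) p q"
  shows "to_succ (mv_spectral_sequence U) n p q r (ss_rel U r n p q `` {x})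
    = ss_rel U r (Suc n) p q `` {x}"
proof -
  have "(x, z) \<in> ss_rel U r (Suc n) p q"
    if "z \<in> ss_rel U r n p q `` {x} \<inter> ss_cycles U r (int (Suc n)) p q" for z
  proof -
    have "x - z \<in> ss_bounds U r (int n) p q" "z \<in> ss_cycles U r (int (Suc n)) p q"
      using that by (auto simp: ss_rel_def)
    then show ?thesis
      using ss_bounds_Suc[of "x - z" U r "int n" p q] diff_in_ss_cycles[OF assms(1), of z] assms(1)
      by (simp add: ss_rel_def add.commute)
  qed
  moreover have "x \<in> ss_rel U r n p q `` {x} \<inter> ss_cycles U r (int (Suc n)) p q"
    using self_in_class[OF assms(2)] assms(1) by blast
  ultimately show ?thesis
    unfolding mv_spectral_sequence_def spectral_sequence.simps by (intro ss_rel_Image_eq)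
qed

text \<open>A cycle whose class has zero differential need not itself be a cycle of the next page.
  If \<open>total_diff x = b + total_diff c\<close>, then \<open>x - c\<close> is one, and
  \<open>c\<close> lies in the lower filtration part that is divided out.\<close>

lemma page_diff_zero_representative:
  assumes x: "x \<in> ss_cycles U r (int n) p q"
    and zero: "page_diff (mv_spectral_sequence U) n p q r (ss_rel U r n p q `` {x}) =
      zero_class (mv_spectral_sequence U) n (p - int n) (q + int n - 1) r"
  obtains y where "y \<in> ss_cycles U r (int (Suc n)) p q" "y \<in> ss_cycles U r (int n) p q"
    "ss_rel U r n p q `` {x} = ss_rel U r n p q `` {y}"
proof -
  have "ss_rel U r n (p - int n) (q + int n - 1) `` {total_diff x} = ss_rel U r n (p - int n) (q + int n - 1) `` {0}"
    using zero unfolding page_diff_class_eq[OF x] by (simp add: mv_spectral_sequence_def)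
  then have "total_diff x \<in> ss_bounds U r (int n) (p - int n) (q + int n - 1)"
    unfolding ss_rel_class_eq_iff[OF total_diff_in_ss_cycles[OF x] zero_in_ss_cycles] by simp
  then obtain b c where b: "b \<in> ss_cycles U r (int n - 1) (p - int n - 1) (q + int n)"
    and c: "c \<in> ss_cycles U r (int n - 1) (p - 1) (q + 1)" and eq: "total_diff x = b + total_diff c"
    by (rule ss_boundsE) (simp add: algebra_simps)
  have cn: "c \<in> ss_cycles U r (int n) p q"
    using c by (rule lower_in_ss_cycles)
  have y: "x - c \<in> ss_cycles U r (int n) p q"
    using x cn by (rule diff_in_ss_cycles)
  have "total_diff (x - c) = b"
    using linear_op_diff[OF linear_op_total_diff ss_cycles_fin_supp[OF x] ss_cycles_fin_supp[OF c]]
    by (simp add: eq)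
  \<comment> \<open>The filtration degree of \<open>b\<close> is at most \<open>p - n - 1\<close>,
    the bound for page \<open>n + 1\<close>.\<close>
  then have "x - c \<in> ss_cycles U r (int (Suc n)) p q"
    using y b by (simp add: ss_cycles_def algebra_simps)
  moreover have "ss_rel U r n p q `` {x} = ss_rel U r n p q `` {x - c}"
    unfolding ss_rel_class_eq_iff[OF x y] using lower_in_ss_bounds[OF c] by simp
  ultimately show thesis
    using y by (intro that)
qed

text \<open>The index set of simplices of the nerve is the same at all parameters; only the
  intersections grow.\<close>

lemma tot_filtration_parameter_mono:
  assumes "\<forall>Y\<in>U. filtered_complex Y" "r \<le> s"
  shows "(tot_filtration U r p m :: ('v, 'k::field) chain set) \<subseteq> tot_filtration U s p m"
proof -
  have "inter \<sigma> r \<subseteq> inter \<sigma> s" if "\<sigma> \<in> nerve U" for \<sigma>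
  proof -
    have "Y r \<subseteq> Y s" if "Y \<in> \<sigma>" for Y
    proof -
      have "Y \<in> U" using that \<open>\<sigma> \<in> nerve U\<close> by (auto simp: nerve_def)
      then show ?thesis using assms by (simp add: filtered_complex_def)
    qed
    then show ?thesis by (fastforce simp: inter_def)
  qed
  then have "c \<in> tot_chains U s" if "c \<in> tot_chains U r" for c :: "('v, 'k) chain"
    using that unfolding tot_chains_def mem_Collect_eq by (meson subsetD)
  then show ?thesis
    by (auto simp: tot_filtration_def)
qed

lemma transition_class_eq:
  fixes x :: "('v, 'k::field) chain"
  assumes "\<forall>Y\<in>U. filtered_complex Y" "r \<le> s" "x \<in> ss_cycles U r (int n) p q"
  shows "transition (mv_spectral_sequence U) n p q r s (ss_rel U r n p q `` {x}) = ss_rel U s n p q `` {x}"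
    and "x \<in> ss_cycles U s (int n) p q"
proof -
  note mono = subsetD[OF tot_filtration_parameter_mono[OF assms(1,2)]]
  have cyc: "y \<in> ss_cycles U s m i j" if "y \<in> ss_cycles U r m i j" for y :: "('v, 'k) chain" and m i j
    using that by (simp add: ss_cycles_def mono)
  have bounds: "y \<in> ss_bounds U s (int n) p q" if "y \<in> ss_bounds U r (int n) p q" for y :: "('v, 'k) chain"
    using that by (rule ss_boundsE) (rule ss_boundsI[OF cyc cyc])
  have "(x, y) \<in> ss_rel U s n p q" if "y \<in> ss_rel U r n p q `` {x}" for y
    using that cyc bounds by (simp add: ss_rel_def)
  then show "transition (mv_spectral_sequence U) n p q r s (ss_rel U r n p q `` {x}) = ss_rel U s n p q `` {x}"
    unfolding mv_spectral_sequence_def spectral_sequence.simps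
    by (intro ss_rel_Image_eq self_in_class[OF assms(3)])
  show "x \<in> ss_cycles U s (int n) p q"
    by (rule cyc[OF assms(3)])
qed

section \<open>The morphism induced by a refinement map\<close>

lemma push_in_ss_cycles:
  assumes "refinement_map V U \<rho>" "c \<in> ss_cycles V r n p q"
  shows "push \<rho> c \<in> ss_cycles U r n p q"
  using assms push_total_diff[OF ss_cycles_tot_chains[OF assms(2)], of \<rho>]
  unfolding ss_cycles_def by (simp add: push_in_tot_filtration)

lemma push_in_ss_bounds:
  assumes "refinement_map V U \<rho>" "x \<in> ss_bounds V r n p q"
  shows "push \<rho> x \<in> ss_bounds U r n p q"
proof -
  obtain b c where b: "b \<in> ss_cycles V r (n - 1) (p - 1) (q + 1)"
    and c: "c \<in> ss_cycles V r (n - 1) (p + n - 1) (q - n + 2)" and x: "x = b + total_diff c"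
    using assms(2) by (rule ss_boundsE)
  have "push \<rho> x = push \<rho> b + total_diff (push \<rho> c)"
    unfolding x linear_op_add[OF linear_op_push ss_cycles_fin_supp[OF b]
        linear_op_fin_supp[OF linear_op_total_diff ss_cycles_fin_supp[OF c]]]
      push_total_diff[OF ss_cycles_tot_chains[OF c]] by (rule refl)
  then show ?thesis
    by (rule ss_boundsI[OF push_in_ss_cycles[OF assms(1) b] push_in_ss_cycles[OF assms(1) c]])
qed

lemma push_class_eq:
  assumes "refinement_map V U \<rho>" "x \<in> ss_cycles V r (int n) p q"
  shows "refinement_morphism V U \<rho> n p q r (ss_rel V r n p q `` {x}) = ss_rel U r n p q `` {push \<rho> x}"
proof -
  have "(push \<rho> x, z) \<in> ss_rel U r n p q" if mem: "z \<in> push \<rho> ` (ss_rel V r n p q `` {x})" for z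
  proof -
    obtain y where y: "z = push \<rho> y" "(x, y) \<in> ss_rel V r n p q"
      using mem by auto
    note xy = ss_relD[OF y(2)]
    show ?thesis
      using push_in_ss_bounds[OF assms(1) xy(3)] push_in_ss_cycles[OF assms(1) xy(1)]
        push_in_ss_cycles[OF assms(1) xy(2)]
        linear_op_diff[OF linear_op_push ss_cycles_fin_supp[OF xy(1)] ss_cycles_fin_supp[OF xy(2)], of \<rho>]
      by (simp add: ss_rel_def y(1))
  qed
  then show ?thesis
    using ss_rel_Image_eq[of "push \<rho> x" "push \<rho> ` (ss_rel V r n p q `` {x})" U r n p q]
      self_in_class[OF assms(2)] class_in_page[OF assms(2)]
    by (simp add: refinement_morphism_def)
qed

theorem refinement_morphism_is_morphism:
  assumes "\<forall>Y\<in>U. filtered_complex Y" "\<forall>Y\<in>V. filtered_complex Y"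
    and \<rho>: "refinement_map V U \<rho>"
  shows "is_morphism_from k (mv_spectral_sequence V :: ('k::field, ('v, 'k) chain set) spectral_sequence)
    (mv_spectral_sequence U) (refinement_morphism V U \<rho>)"
  unfolding is_morphism_from_def
proof (intro allI ballI impI)
  fix n p q r and A :: "('v, 'k) chain set"
  assume "A \<in> page (mv_spectral_sequence V) n p q r"
  then obtain x where x: "x \<in> ss_cycles V r (int n) p q" and A: "A = ss_rel V r n p q `` {x}"
    by (rule page_cases)
  let ?f = "refinement_morphism V U \<rho> :: ('v, 'k) chain set page_maps"
  let ?E = "mv_spectral_sequence V :: ('k, ('v, 'k) chain set) spectral_sequence"
  let ?E' = "mv_spectral_sequence U :: ('k, ('v, 'k) chain set) spectral_sequence"
  note fA = push_class_eq[OF \<rho> x, folded A]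
  have px: "push \<rho> x \<in> ss_cycles U r (int n) p q"
    by (rule push_in_ss_cycles[OF \<rho> x])
  have "?f n p q r A \<in> page ?E' n p q r"
    unfolding fA by (rule class_in_page[OF px])
  moreover have "?f n p q r (add_class ?E n p q r A B) = add_class ?E' n p q r (?f n p q r A) (?f n p q r B)"
    if mem: "B \<in> page ?E n p q r" for B
  proof -
    obtain y where y: "y \<in> ss_cycles V r (int n) p q" and B: "B = ss_rel V r n p q `` {y}"
      using mem by (rule page_cases)
    show ?thesis
      unfolding A B add_class_eq[OF x y] push_class_eq[OF \<rho> x] push_class_eq[OF \<rho> y]
        push_class_eq[OF \<rho> add_in_ss_cycles[OF x y]] add_class_eq[OF px push_in_ss_cycles[OF \<rho> y]]
        linear_op_add[OF linear_op_push ss_cycles_fin_supp[OF x] ss_cycles_fin_supp[OF y]] by (rule refl)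
  qed
  moreover have "?f n p q r (scale_class ?E n p q r a A) = scale_class ?E' n p q r a (?f n p q r A)" for a
    unfolding A scale_class_eq[OF x] push_class_eq[OF \<rho> x] push_class_eq[OF \<rho> scale_in_ss_cycles[OF x]]
      scale_class_eq[OF px] linear_op_scale[OF linear_op_push ss_cycles_fin_supp[OF x]] by (rule refl)
  moreover have "?f n p q s (transition ?E n p q r s A) = transition ?E' n p q r s (?f n p q r A)" if "s \<ge> r" for s
    unfolding A transition_class_eq(1)[OF assms(2) that x] push_class_eq[OF \<rho> x]
      push_class_eq[OF \<rho> transition_class_eq(2)[OF assms(2) that x]] transition_class_eq(1)[OF assms(1) that px] by (rule refl)
  moreover have "?f n (p - int n) (q + int n - 1) r (page_diff ?E n p q r A) = page_diff ?E' n p q r (?f n p q r A)"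
    unfolding A page_diff_class_eq[OF x] push_class_eq[OF \<rho> x] page_diff_class_eq[OF px]
      push_class_eq[OF \<rho> total_diff_in_ss_cycles[OF x]] push_total_diff[OF ss_cycles_tot_chains[OF x]] by (rule refl)
  moreover have "?f (Suc n) p q r (to_succ ?E n p q r A) = to_succ ?E' n p q r (?f n p q r A)"
    if zero: "page_diff ?E n p q r A = zero_class ?E n (p - int n) (q + int n - 1) r"
  proof -
    \<comment> \<open>\<open>to_succ_class_eq\<close> applies to representatives that are already
      cycles of page \<open>n + 1\<close>, so \<open>x\<close> is replaced first.\<close>
    obtain y where y: "y \<in> ss_cycles V r (int (Suc n)) p q" "y \<in> ss_cycles V r (int n) p q"
      and Ay: "A = ss_rel V r n p q `` {y}"
      using page_diff_zero_representative[OF x zero[unfolded A]] unfolding A by blast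
    show ?thesis
      unfolding Ay to_succ_class_eq[OF y] push_class_eq[OF \<rho> y(1)] push_class_eq[OF \<rho> y(2)]
        to_succ_class_eq[OF push_in_ss_cycles[OF \<rho> y(1)] push_in_ss_cycles[OF \<rho> y(2)]] by (rule refl)
  qed
  ultimately show "?f n p q r A \<in> page ?E' n p q r \<and>
      (\<forall>B\<in>page ?E n p q r. ?f n p q r (add_class ?E n p q r A B) = add_class ?E' n p q r (?f n p q r A) (?f n p q r B)) \<and>
      (\<forall>a. ?f n p q r (scale_class ?E n p q r a A) = scale_class ?E' n p q r a (?f n p q r A)) \<and>
      (\<forall>s\<ge>r. ?f n p q s (transition ?E n p q r s A) = transition ?E' n p q r s (?f n p q r A)) \<and>
      ?f n (p - int n) (q + int n - 1) r (page_diff ?E n p q r A) = page_diff ?E' n p q r (?f n p q r A) \<and>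
      (page_diff ?E n p q r A = zero_class ?E n (p - int n) (q + int n - 1) r \<longrightarrow>
         ?f (Suc n) p q r (to_succ ?E n p q r A) = to_succ ?E' n p q r (?f n p q r A))"
    by blast
qed

lemma is_morphism_from_restrict_pages:
  "is_morphism_from k E E' f \<Longrightarrow> is_morphism_from k E E' (restrict_pages k f)"
  unfolding is_morphism_from_def restrict_pages_def by simp

section \<open>Independence of the choice from page 2 on\<close>

lemma push_update_diff_in_ss_bounds:
  fixes x :: "('v, 'k::field) chain"
  assumes \<rho>: "refinement_map V U \<rho>" and \<rho>': "refinement_map V U (\<rho>(A := Q))"
    and x: "x \<in> ss_cycles V r n p q" and n: "n \<ge> 2"
  shows "push (\<rho>(A := Q)) x - push \<rho> x \<in> ss_bounds U r n p q"
proof -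
  let ?h = "cone_homotopy A Q \<rho> :: ('v, 'k) chain \<Rightarrow> ('v, 'k) chain"
  have xF: "x \<in> tot_filtration V r p (p + q)" and DxF: "total_diff x \<in> tot_filtration V r (p - n) (p + q - 1)"
    using x by (simp_all add: ss_cycles_def)
  have hx: "?h x \<in> tot_filtration U r (p + 1) (p + q + 1)"
    by (rule cone_homotopy_in_tot_filtration[OF \<rho> \<rho>' xF])
  have hDx: "?h (total_diff x) \<in> tot_filtration U r (p - n + 1) (p + q)"
    using cone_homotopy_in_tot_filtration[OF \<rho> \<rho>' DxF] by simp
  have eq: "total_diff (?h x) + ?h (total_diff x) = push (\<rho>(A := Q)) x - push \<rho> x"
    by (rule cone_homotopy_total_diff[OF ss_cycles_tot_chains[OF x]])
  \<comment> \<open>The homotopy formula at \<open>total_diff x\<close>, where the term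
    \<open>?h (total_diff (total_diff x))\<close> is zero. It bounds the filtration degree by that
    of \<open>total_diff x\<close>.\<close>
  have "total_diff (?h (total_diff x)) = push (\<rho>(A := Q)) (total_diff x) - push \<rho> (total_diff x)"
    using cone_homotopy_total_diff[OF tot_filtration_tot_chains[OF DxF], of A Q \<rho>]
    by (simp only: total_diff_total_diff[OF ss_cycles_tot_chains[OF x]] linear_op_zero[OF linear_op_cone_homotopy] add_0_right)
  also have "\<dots> \<in> tot_filtration U r (p - n) (p + q - 1)"
    by (intro diff_in_tot_filtration push_in_tot_filtration[OF \<rho>] push_in_tot_filtration[OF \<rho>'] DxF)
  \<comment> \<open>Here \<open>n \<ge> 2\<close> gives \<open>p - n + 1 \<le> p - 1\<close>; the
    differential has to lie in degree \<open>(p - 1) - (n - 1) = p - n\<close>.\<close>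
  finally have "?h (total_diff x) \<in> ss_cycles U r (n - 1) (p - 1) (q + 1)"
    using n tot_filtration_mono[OF hDx, of "p - 1"] by (simp add: ss_cycles_def)
  \<comment> \<open>Solving the homotopy formula for this term places it in degree
    \<open>p = (p + n - 1) - (n - 1)\<close>, as \<open>?h x\<close> has to satisfy in the second
    kind of boundary.\<close>
  moreover have "total_diff (?h x) = push (\<rho>(A := Q)) x - push \<rho> x - ?h (total_diff x)"
    by (simp only: eq[symmetric] add_diff_cancel_right')
  then have "total_diff (?h x) \<in> tot_filtration U r p (p + q)"
    using n tot_filtration_mono[OF hDx, of p]
    by (simp only:) (intro diff_in_tot_filtration push_in_tot_filtration[OF \<rho>] push_in_tot_filtration[OF \<rho>'] xF; simp)
  then have "?h x \<in> ss_cycles U r (n - 1) (p + n - 1) (q - n + 2)"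
    using n tot_filtration_mono[OF hx, of "p + n - 1"] by (simp add: ss_cycles_def algebra_simps)
  ultimately show ?thesis
    by (rule ss_boundsI) (simp only: eq[symmetric] add.commute)
qed

text \<open>A chain involves finitely many members of \<open>V\<close>, so that \<open>\<rho>\<close> can be changed into \<open>\<tau>\<close> one
  vertex at a time. By contiguity all intermediate vertex maps are refinement maps.\<close>

lemma push_diff_in_ss_bounds:
  fixes x :: "('v, 'k::field) chain"
  assumes \<rho>: "refinement_map V U \<rho>" and \<tau>: "refinement_map V U \<tau>"
    and x: "x \<in> ss_cycles V r n p q" and n: "n \<ge> 2"
  shows "push \<tau> x - push \<rho> x \<in> ss_bounds U r n p q"
proof -
  define mix where "mix B = (\<lambda>Y. if Y \<in> B then \<tau> Y else \<rho> Y)" for B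
  have mix: "refinement_map V U (mix B)" for B
    unfolding refinement_map_def
  proof (intro ballI conjI allI)
    fix \<sigma> r
    assume \<sigma>: "\<sigma> \<in> nerve V"
    have sub: "mix B ` \<sigma> \<subseteq> \<rho> ` \<sigma> \<union> \<tau> ` \<sigma>" and ne: "mix B ` \<sigma> \<noteq> {}"
      using \<sigma> by (auto simp: mix_def nerve_def)
    show "mix B ` \<sigma> \<in> nerve U" "inter \<sigma> r \<subseteq> inter (mix B ` \<sigma>) r"
      by (rule refinement_map_contiguous[OF \<rho> \<tau> \<sigma> sub ne])+
  qed
  have step: "push (mix B) x - push \<rho> x \<in> ss_bounds U r n p q" if "finite B" for B
    using that
  proof (induction B rule: finite_induct)
    case empty
    have "mix {} = \<rho>"
      by (simp add: mix_def)
    then show ?case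
      by (simp only: diff_self zero_in_ss_bounds)
  next
    case (insert A B)
    have upd: "mix (insert A B) = (mix B)(A := \<tau> A)"
      by (auto simp: mix_def)
    have "push (mix (insert A B)) x - push (mix B) x \<in> ss_bounds U r n p q"
      using push_update_diff_in_ss_bounds[OF mix[of B] mix[of "insert A B", unfolded upd] x n]
      unfolding upd .
    from add_in_ss_bounds[OF this insert.IH] show ?case
      by (simp only: add_diff_eq diff_add_cancel)
  qed
  define B where "B = (\<Union>y\<in>{y. x y \<noteq> 0}. set (fst y))"
  have "finite B"
    using ss_cycles_fin_supp[OF x] by (auto simp: B_def fin_supp_def)
  moreover have "push (mix B) x = push \<tau> x"
  proof -
    have "map (mix B) s = map \<tau> s" if "x (s, a) \<noteq> 0" for s a
      using that by (force simp: B_def mix_def)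
    then have "(if map (mix B) s = t \<and> distinct t then x (s, a) else 0)
        = (if map \<tau> s = t \<and> distinct t then x (s, a) else 0)" for s t a
      by (cases "x (s, a) = 0") auto
    then show ?thesis by (simp add: push_def)
  qed
  ultimately show ?thesis
    using step by metis
qed

text \<open>Below page 2, and outside the elements of a page, both maps take the value
  \<open>undefined\<close>. Equality as functions thus reduces to classes on pages from 2
  on.\<close>

theorem refinement_2morphism_independent:
  assumes "refinement_map V U \<rho>" "refinement_map V U \<tau>"
  shows "(refinement_2morphism V U \<rho> :: ('v, 'k::field) chain set page_maps) = refinement_2morphism V U \<tau>"
proof -
  have "(refinement_morphism V U \<rho> n p q r :: ('v, 'k) chain set \<Rightarrow> _) = refinement_morphism V U \<tau> n p q r"
    if n: "n \<ge> 2" for n p q r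
  proof
    fix A :: "('v, 'k) chain set"
    show "refinement_morphism V U \<rho> n p q r A = refinement_morphism V U \<tau> n p q r A"
    proof (cases "A \<in> page (mv_spectral_sequence V) n p q r")
      case True
      then obtain x where x: "x \<in> ss_cycles V r (int n) p q" and A: "A = ss_rel V r n p q `` {x}"
        by (rule page_cases)
      have "push \<rho> x - push \<tau> x \<in> ss_bounds U r (int n) p q"
        using n by (intro push_diff_in_ss_bounds[OF assms(2,1) x]) simp
      then show ?thesis
        unfolding A push_class_eq[OF assms(1) x] push_class_eq[OF assms(2) x]
        by (simp add: ss_rel_class_eq_iff push_in_ss_cycles[OF assms(1) x] push_in_ss_cycles[OF assms(2) x])
    qed (simp add: refinement_morphism_def)
  qed
  then show ?thesis
    by (simp add: refinement_2morphism_def restrict_pages_def fun_eq_iff)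
qed

theorem proposition7p2:
  fixes X :: "'v filtered" and U V :: "'v filtered set"
    and \<rho> \<tau> :: "'v filtered \<Rightarrow> 'v filtered"
  assumes "filtered_complex X"
    and "cover X U" and "cover X V"
    and "finer V U"
    and "refinement_map V U \<rho>" and "refinement_map V U \<tau>"
  shows "is_morphism_from 2
           (mv_spectral_sequence V :: ('k::field, ('v, 'k) chain set) spectral_sequence)
           (mv_spectral_sequence U) (refinement_2morphism V U \<rho>)
       \<and> (refinement_2morphism V U \<rho> :: ('v, 'k) chain set page_maps)
           = refinement_2morphism V U \<tau>"
proof
  \<comment> \<open>Growth of the members with the parameter lets the transition maps of both
    spectral sequences be computed on representatives.\<close>
  have "filtered_complex Y" if "Y \<in> U \<or> Y \<in> V" for Y
    using that assms(2,3) by (auto simp: cover_def filtered_subcomplex_def)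
  then show "is_morphism_from 2
           (mv_spectral_sequence V :: ('k::field, ('v, 'k) chain set) spectral_sequence)
           (mv_spectral_sequence U) (refinement_2morphism V U \<rho>)"
    unfolding refinement_2morphism_def
    by (intro is_morphism_from_restrict_pages refinement_morphism_is_morphism assms(5)) simp_all
  show "(refinement_2morphism V U \<rho> :: ('v, 'k) chain set page_maps) = refinement_2morphism V U \<tau>"
    by (rule refinement_2morphism_independent[OF assms(5,6)])
qed

end
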